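(* Let $K\subset \mathbb{R}^n_q$ be a centrally symmetric strictly convex body such that $K$ and $K^\circ$ have smooth boundary. Then the minimum of the $\|\cdot\|_K$-length over all periodic $K^{\circ}$-billiard trajectories in $K$ is attained, and it is attained exclusively by two-bouncing orbits. In particular, the minimal $\|\cdot\|_K$-length of a periodic $K^{\circ}$-billiard trajectory in $K$ is $4$.
   Context: A convex body is a compact convex set with non-empty interior; it is centrally symmetric if it equals its reflection in the origin. For a convex body $K$ with the origin in its interior, $g_K(x)=\inf\{r>0 : x\in rK\}$ is its gauge function; if $K$ is centrally symmetric, $g_K=\|\cdot\|_K$ is the norm with unit ball $K$. The polar body of a centrally symmetric $K\subset\mathbb{R}^n_q$ is $K^\circ = \{p\in\mathbb{R}^n_p : \langle p,q\rangle \le 1 \text{ for every } q\in K\}$. Let $K\subset\mathbb{R}^n_q$ and $T\subset\mathbb{R}^n_p$ be convex bodies with smooth boundary. A closed $(K,T)$-billiard trajectory is the image of a piecewise smooth map $\gamma:S^1\to\partial(K\times T)$ such that, with $\mathcal{B}_\gamma=\{t\in S^1 : \gamma(t)\in\partial K\times\partial T\}$, for every $t\notin\mathcal{B}_\gamma$ one has $\dot\gamma(t)=d\,\mathfrak{X}(\gamma(t))$ for some positive constant $d$, where $$\mathfrak{X}(q,p)=\begin{cases}(-\nabla g_T(p),0), & (q,p)\in \mathrm{int}(K)\times\partial T,\\ (0,\nabla g_K(q)), & (q,p)\in\partial K\times \mathrm{int}(T),\end{cases}$$ and for every $t\in\mathcal{B}_\gamma$ the left and right derivatives of $\gamma$ at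 $t$ exist and lie in $$\{\alpha(-\nabla g_T(p),0)+\beta(0,\nabla g_K(q)) : \alpha,\beta\ge 0,\ (\alpha,\beta)\ne(0,0)\},\qquad (q,p)=\gamma(t).$$ If $\pi_q:\mathbb{R}^{2n}=\mathbb{R}^n_q\times\mathbb{R}^n_p\to\mathbb{R}^n_q$ is the projection, the closed curve $\pi_q(\gamma)$ is called a (periodic) $T$-billiard trajectory in $K$. A $K^\circ$-billiard trajectory in $K$ is the case $T=K^\circ$. Its $\|\cdot\|_K$-length is the length of the closed curve $\pi_q(\gamma)$ measured with the norm $\|\cdot\|_K$ (for a closed polygonal curve, the sum of the $\|\cdot\|_K$-lengths of its edges). A two-bouncing orbit is a periodic billiard trajectory with exactly two bounce points on $\partial K$, i.e. one that goes back and forth along a segment joining two points of $\partial K$, traversed once in each direction. *)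

theory Defs
  imports "HOL-Analysis.Analysis"
begin

definition convex_body :: "'a::euclidean_space set \<Rightarrow> bool" where
  "convex_body K \<longleftrightarrow> compact K \<and> convex K \<and> interior K \<noteq> {}"

definition centrally_symmetric :: "'a::euclidean_space set \<Rightarrow> bool" where
  "centrally_symmetric K \<longleftrightarrow> uminus ` K = K"

definition strictly_convex :: "'a::euclidean_space set \<Rightarrow> bool" where
  "strictly_convex K \<longleftrightarrow> (\<forall>x\<in>K. \<forall>y\<in>K. open_segment x y \<subseteq> interior K)"

text \<open>The Minkowski functional; it is the norm with unit ball \<open>K\<close> if \<open>K\<close> is a
  centrally symmetric convex body.\<close>

definition gauge_fun :: "'a::euclidean_space set \<Rightarrow> 'a \<Rightarrow> real" where
  "gauge_fun K x = Inf {r. r > 0 \<and> x \<in> (\<lambda>y. r *\<^sub>R y) ` K}"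

definition polar_body :: "'a::euclidean_space set \<Rightarrow> 'a set" where
  "polar_body K = {p. \<forall>q\<in>K. p \<bullet> q \<le> 1}"

definition grad :: "('a::euclidean_space \<Rightarrow> real) \<Rightarrow> 'a \<Rightarrow> 'a" where
  "grad f x = (THE D. GDERIV f x :> D)"

text \<open>Differentiability classes, used only on open sets and on nondegenerate compact intervals,
  where the derivative within the set is unique. On an interval the derivatives at the
  endpoints are one-sided. In finite dimension, \<open>f'\<close> is \<open>C\<^sup>k\<close> iff all
  \<open>\<lambda>x. f' x v\<close> are.\<close>

primrec Ck_on :: "nat \<Rightarrow> 'a::euclidean_space set \<Rightarrow> ('a \<Rightarrow> 'b::euclidean_space) \<Rightarrow> bool" where
  "Ck_on 0 S f \<longleftrightarrow> continuous_on S f"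
| "Ck_on (Suc k) S f \<longleftrightarrow>
     (\<exists>f'. (\<forall>x\<in>S. (f has_derivative f' x) (at x within S)) \<and> (\<forall>v. Ck_on k S (\<lambda>x. f' x v)))"

definition smooth_on :: "'a::euclidean_space set \<Rightarrow> ('a \<Rightarrow> 'b::euclidean_space) \<Rightarrow> bool" where
  "smooth_on S f \<longleftrightarrow> (\<forall>k. Ck_on k S f)"

text \<open>The boundary is a smooth embedded hypersurface: locally the zero set of a smooth
  function with nonvanishing gradient.\<close>

definition smooth_boundary :: "'a::euclidean_space set \<Rightarrow> bool" where
  "smooth_boundary K \<longleftrightarrow>
     (\<forall>x\<in>frontier K. \<exists>U (\<rho> :: 'a \<Rightarrow> real). open U \<and> x \<in> U \<and> smooth_on U \<rho> \<and>
        (\<forall>y\<in>U. grad \<rho> y \<noteq> 0) \<and> frontier K \<inter> U = {y\<in>U. \<rho> y = 0})"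

text \<open>A closed curve is a 1-periodic function on the real line, the circle being
  \<open>\<real>/\<int>\<close>.\<close>

definition closed_curve :: "(real \<Rightarrow> 'a) \<Rightarrow> bool" where
  "closed_curve c \<longleftrightarrow> (\<forall>t. c (t + 1) = c t)"

definition piecewise_smooth_closed_curve :: "(real \<Rightarrow> 'a::euclidean_space) \<Rightarrow> bool" where
  "piecewise_smooth_closed_curve c \<longleftrightarrow>
     closed_curve c \<and> continuous_on UNIV c \<and>
     (\<exists>S. finite S \<and>
        (\<forall>a b. 0 \<le> a \<and> a < b \<and> b \<le> 1 \<and> {a<..<b} \<inter> S = {} \<longrightarrow> smooth_on {a..b} c))"

text \<open>The second branch is only meant for \<open>(q, p) \<in> frontier K \<times> interior T\<close>.\<close>

definition billiard_field ::
    "'a::euclidean_space set \<Rightarrow> 'a set \<Rightarrow> 'a \<times> 'a \<Rightarrow> 'a \<times> 'a" where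
  "billiard_field K T = (\<lambda>(q, p).
     if q \<in> interior K \<and> p \<in> frontier T
     then (- grad (gauge_fun T) p, 0)
     else (0, grad (gauge_fun K) q))"

definition billiard_cone ::
    "'a::euclidean_space set \<Rightarrow> 'a set \<Rightarrow> 'a \<times> 'a \<Rightarrow> ('a \<times> 'a) set" where
  "billiard_cone K T = (\<lambda>(q, p).
     {\<alpha> *\<^sub>R (- grad (gauge_fun T) p, 0) + \<beta> *\<^sub>R (0, grad (gauge_fun K) q) | \<alpha> \<beta> :: real.
        \<alpha> \<ge> 0 \<and> \<beta> \<ge> 0 \<and> (\<alpha>, \<beta>) \<noteq> (0, 0)})"

definition closed_KT_billiard_trajectory ::
    "'a::euclidean_space set \<Rightarrow> 'a set \<Rightarrow> (real \<Rightarrow> 'a \<times> 'a) \<Rightarrow> bool" where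
  "closed_KT_billiard_trajectory K T \<gamma> \<longleftrightarrow>
     piecewise_smooth_closed_curve \<gamma> \<and>
     (\<forall>t. \<gamma> t \<in> frontier (K \<times> T)) \<and>
     (\<exists>d>0. \<forall>t. \<gamma> t \<notin> frontier K \<times> frontier T \<longrightarrow>
        (\<gamma> has_vector_derivative d *\<^sub>R billiard_field K T (\<gamma> t)) (at t)) \<and>
     (\<forall>t. \<gamma> t \<in> frontier K \<times> frontier T \<longrightarrow>
        (\<exists>v\<in>billiard_cone K T (\<gamma> t). (\<gamma> has_vector_derivative v) (at_left t)) \<and>
        (\<exists>v\<in>billiard_cone K T (\<gamma> t). (\<gamma> has_vector_derivative v) (at_right t)))"

definition billiard_trajectory ::
    "'a::euclidean_space set \<Rightarrow> 'a set \<Rightarrow> (real \<Rightarrow> 'a) \<Rightarrow> bool" where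
  "billiard_trajectory T K q \<longleftrightarrow>
     (\<exists>\<gamma>. closed_KT_billiard_trajectory K T \<gamma> \<and> q = fst \<circ> \<gamma>)"

text \<open>The length of a closed curve over one period. The derivative is only relevant at the
  (all but finitely many, modulo 1) parameters where it exists.\<close>

definition gauge_length :: "'a::euclidean_space set \<Rightarrow> (real \<Rightarrow> 'a) \<Rightarrow> real" where
  "gauge_length K q = integral {0..1} (\<lambda>t. gauge_fun K (vector_derivative q (at t)))"

text \<open>Up to the choice of the starting parameter \<open>s\<close>, the curve runs monotonically along the
  segment from \<open>a\<close> to \<open>b\<close> and then monotonically back. Monotonicity is not strict because
  \<open>q\<close> rests at a bounce point while the momentum component moves.\<close>

definition two_bouncing_orbit ::
    "'a::euclidean_space set \<Rightarrow> 'a set \<Rightarrow> (real \<Rightarrow> 'a) \<Rightarrow> bool" where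
  "two_bouncing_orbit T K q \<longleftrightarrow>
     billiard_trajectory T K q \<and>
     (\<exists>a b. a \<noteq> b \<and> range q \<inter> frontier K = {a, b} \<and>
        (\<exists>s m u. s < m \<and> m < s + 1 \<and>
           (\<forall>t\<in>{s..s + 1}. q t = linepath a b (u t)) \<and>
           u s = 0 \<and> u m = 1 \<and> u (s + 1) = 0 \<and>
           mono_on {s..m} u \<and> antimono_on {m..s + 1} u))"

end

theory Submission
  imports Defs
begin

text \<open>Write \<open>g\<close> for the norm with unit ball \<open>K\<close> and \<open>T\<close> for the polar body. By duality \<open>g\<close> is the
  support function of \<open>T\<close>, and the gauge of \<open>T\<close> is the support function of \<open>K\<close>. Hence the gradient
  of \<open>g\<close> at a boundary point \<open>x\<close> is the unique \<open>p \<in> T\<close> with \<open>p \<bullet> x = 1\<close> (unique because the boundary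
  of \<open>K\<close> is smooth), and the gradient of the gauge of \<open>T\<close> at \<open>p\<close> is the unique \<open>x \<in> K\<close> with
  \<open>p \<bullet> x = 1\<close> (unique because \<open>K\<close> is strictly convex).

  Let \<open>(q, p)\<close> be a closed trajectory of length \<open>L\<close>. Bouncing and gliding motions alike satisfy, at
  all but finitely many times, \<open>g q' = - (p \<bullet> q')\<close> and \<open>p' \<bullet> z \<le> g z * (q \<bullet> p')\<close> for every \<open>z\<close>.
  The first relation and integration by parts give that \<open>q \<bullet> p'\<close> has integral \<open>L\<close>. Cut the curve \<open>q\<close>
  into two arcs of length \<open>L/2\<close> and let \<open>z\<close> be the midpoint of the two cutting points; by the
  triangle inequality the whole curve stays within distance \<open>L/4\<close> of \<open>z\<close>. As \<open>p\<close> is closed,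
  \<open>p' \<bullet> (q - z)\<close> also has integral \<open>L\<close>, and the second relation bounds this by \<open>L/4 * L\<close>.
  So \<open>L \<ge> 4\<close> (\<open>length_ge_4\<close>).

  If \<open>L = 4\<close>, equality forces \<open>z \<bullet> p' = 0\<close>, so that \<open>q - z\<close> and \<open>q\<close> maximise the same functional
  on \<open>K\<close>; strict convexity gives \<open>z = 0\<close> (\<open>halving_points_antipodal\<close>). Cut at a bounce point \<open>x\<close>.
  Then the other cutting point is \<open>- x\<close>, and each arc has length 2, the distance from \<open>x\<close> to \<open>- x\<close>. In
  a strictly convex norm it therefore runs monotonically along the segment
  (\<open>shortest_is_two_bouncing\<close>). Conversely, going back and forth between any boundary point and its
  antipode is a trajectory of length 4 (\<open>two_bounce_trajectory\<close>).\<close>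

section \<open>Gradients of support functions\<close>

definition support_function :: "'a::euclidean_space set \<Rightarrow> ('a \<Rightarrow> real) \<Rightarrow> bool" where
  "support_function C f \<longleftrightarrow> (\<forall>x. (\<forall>c\<in>C. c \<bullet> x \<le> f x) \<and> (\<exists>c\<in>C. c \<bullet> x = f x))"

lemma support_functionD: "support_function C f \<Longrightarrow> c \<in> C \<Longrightarrow> c \<bullet> x \<le> f x"
  by (simp add: support_function_def)

lemma support_functionE:
  assumes "support_function C f"
  obtains c where "c \<in> C" "c \<bullet> x = f x"
  using assms by (auto simp: support_function_def)

lemma grad_eqI:
  assumes "GDERIV f x :> D"
  shows "grad f x = D"
  unfolding grad_def
proof (rule the_equality)
  show "GDERIV f x :> D" by (rule assms)
  fix D' assume "GDERIV f x :> D'"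
  then have "(\<lambda>h. h \<bullet> D') = (\<lambda>h. h \<bullet> D)"
    using assms unfolding gderiv_def by (rule has_derivative_unique)
  then have "(D' - D) \<bullet> (D' - D) = 0"
    by (metis inner_diff_right right_minus_eq)
  then show "D' = D" by simp
qed

text \<open>At \<open>x\<close>, the support function of a compact set has the gradient \<open>c\<close> if \<open>c\<close> is the only point of the
  set that maximises the product with \<open>x\<close>: by compactness, points that maximise the product with
  a nearby \<open>y\<close> are close to \<open>c\<close>, and the error in the linear approximation is at most
  \<open>(d - c) \<bullet> (y - x)\<close> for such a point \<open>d\<close>.\<close>

lemma GDERIV_support_function:
  fixes f :: "'a::euclidean_space \<Rightarrow> real"
  assumes f: "support_function C f" and C: "compact C"
    and c: "c \<in> C" "c \<bullet> x = f x"
    and unique: "\<And>c'. c' \<in> C \<Longrightarrow> c' \<bullet> x = f x \<Longrightarrow> c' = c"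
  shows "GDERIV f x :> c"
  unfolding gderiv_def has_derivative_at_alt
proof (intro conjI allI impI)
  show "bounded_linear (\<lambda>h. h \<bullet> c)" by (rule bounded_linear_inner_left)
  fix e :: real assume e: "e > 0"
  obtain R where R: "R > 0" "\<And>d. d \<in> C \<Longrightarrow> norm d \<le> R"
    using compact_imp_bounded[OF C] by (auto simp: bounded_pos)
  \<comment> \<open>away from \<open>c\<close>, the product with \<open>x\<close> stays below its maximum by a fixed gap\<close>
  obtain \<eta> where \<eta>: "\<eta> > 0" "\<And>d. d \<in> C \<Longrightarrow> norm (d - c) \<ge> e \<Longrightarrow> d \<bullet> x \<le> f x - \<eta>"
  proof (cases "C - ball c e = {}")
    case True
    then have "\<not> norm (d - c) \<ge> e" if "d \<in> C" for d
      using that by (auto simp: dist_norm norm_minus_commute)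
    then show ?thesis using that[of 1] by auto
  next
    case False
    have "compact (C - ball c e)" by (simp add: C compact_diff)
    moreover have "continuous_on (C - ball c e) (\<lambda>d. d \<bullet> x)" by (intro continuous_intros)
    ultimately have "\<exists>d0\<in>C - ball c e. \<forall>d\<in>C - ball c e. d \<bullet> x \<le> d0 \<bullet> x"
      using continuous_attains_sup False by blast
    then obtain d0 where d0: "d0 \<in> C - ball c e" "\<And>d. d \<in> C - ball c e \<Longrightarrow> d \<bullet> x \<le> d0 \<bullet> x"
      by blast
    have "d0 \<noteq> c" using d0 e by auto
    then have "d0 \<bullet> x < f x"
      using unique[of d0] support_functionD[OF f, of d0 x] d0 by fastforce
    then show ?thesis
      using d0(2) by (intro that[of "f x - d0 \<bullet> x"]) (auto simp: dist_norm norm_minus_commute)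
  qed
  have "norm (f y - f x - (y - x) \<bullet> c) \<le> e * norm (y - x)"
    if y: "norm (y - x) < \<eta> / (2 * R)" for y
  proof -
    obtain d where d: "d \<in> C" "d \<bullet> y = f y" using support_functionE[OF f] by blast
    have lower: "f y - f x - (y - x) \<bullet> c \<ge> 0"
      using support_functionD[OF f c(1), of y] c(2) by (simp add: inner_diff_left inner_diff_right inner_commute)
    have "f x - d \<bullet> x \<le> (d - c) \<bullet> (y - x)"
      using support_functionD[OF f c(1), of y] c(2) d by (simp add: algebra_simps inner_diff_left inner_diff_right inner_commute)
    also have "\<dots> \<le> norm (d - c) * norm (y - x)" by (rule norm_cauchy_schwarz)
    also have "\<dots> \<le> (2 * R) * norm (y - x)"
      using norm_triangle_ineq4[of d c] R(2)[OF d(1)] R(2)[OF c(1)]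
      by (intro mult_right_mono) auto
    also have "\<dots> < \<eta>" using y R(1) by (simp add: field_simps)
    finally have close: "norm (d - c) < e" using \<eta>(2)[OF d(1)] by fastforce
    have "f y - f x - (y - x) \<bullet> c \<le> (d - c) \<bullet> (y - x)"
      using support_functionD[OF f d(1), of x] d(2) by (simp add: algebra_simps inner_diff_left inner_diff_right inner_commute)
    also have "\<dots> \<le> norm (d - c) * norm (y - x)" by (rule norm_cauchy_schwarz)
    also have "\<dots> \<le> e * norm (y - x)" using close by (intro mult_right_mono) auto
    finally show ?thesis using lower by simp
  qed
  then show "\<exists>d>0. \<forall>y. norm (y - x) < d \<longrightarrow> norm (f y - f x - (y - x) \<bullet> c) \<le> e * norm (y - x)"
    using \<eta>(1) R(1) by (intro exI[of _ "\<eta> / (2 * R)"]) auto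
qed

section \<open>The norm of a symmetric body and its dual\<close>

locale symmetric_body =
  fixes K :: "'a::euclidean_space set"
  assumes convex_body: "convex_body K" and symmetric: "centrally_symmetric K"
begin

abbreviation "T \<equiv> polar_body K"
abbreviation "g \<equiv> gauge_fun K"

lemma compact_K: "compact K" and convex_K: "convex K" and closed_K: "closed K"
  using convex_body by (auto simp: convex_body_def compact_imp_closed)

lemma uminus_mem: "x \<in> K \<Longrightarrow> - x \<in> K"
  using symmetric by (auto simp: centrally_symmetric_def)

text \<open>A point of the interior and its reflection have the origin as their midpoint.\<close>

lemma zero_interior: "0 \<in> interior K"
proof -
  obtain z where z: "z \<in> interior K" using convex_body by (auto simp: convex_body_def)
  have "- z \<in> uminus ` interior K" using z by simp
  also have "uminus ` interior K = interior (uminus ` K)" by (rule interior_negations[symmetric])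
  also have "uminus ` K = K" using symmetric by (simp add: centrally_symmetric_def)
  finally have "(1/2) *\<^sub>R z + (1/2) *\<^sub>R (- z) \<in> interior K"
    using z convex_interior[OF convex_K] by (intro convexD) auto
  then show ?thesis by simp
qed

lemma zero_mem: "0 \<in> K"
  using zero_interior interior_subset by blast

lemma polar_le_one: "p \<in> T \<Longrightarrow> x \<in> K \<Longrightarrow> p \<bullet> x \<le> 1"
  by (simp add: polar_body_def)

lemma zero_mem_polar: "0 \<in> T"
  by (simp add: polar_body_def)

text \<open>A hyperplane that strictly separates \<open>z\<close> from \<open>K\<close> misses the origin, so it can be normalised to
  an element of the polar body.\<close>

lemma polar_separation:
  assumes "z \<notin> K"
  obtains p where "p \<in> T" "p \<bullet> z > 1"
proof -
  obtain a b where ab: "a \<bullet> z < b" "\<And>x. x \<in> K \<Longrightarrow> a \<bullet> x > b"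
    using separating_hyperplane_closed_point[OF convex_K closed_K assms] by blast
  have b: "b < 0" using ab(2)[OF zero_mem] by simp
  have "(1/b) *\<^sub>R a \<in> T"
    using ab(2) b by (auto simp: polar_body_def divide_simps intro: less_imp_le)
  moreover have "((1/b) *\<^sub>R a) \<bullet> z > 1"
    using ab(1) b by (simp add: divide_simps)
  ultimately show ?thesis by (rule that)
qed

lemma bipolar: "polar_body T = K"
proof
  show "K \<subseteq> polar_body T" by (auto simp: polar_body_def inner_commute)
  show "polar_body T \<subseteq> K"
  proof
    fix z assume z: "z \<in> polar_body T"
    show "z \<in> K"
    proof (rule ccontr)
      assume "z \<notin> K"
      then obtain p where "p \<in> T" "p \<bullet> z > 1" by (rule polar_separation)
      then show False using z by (auto simp: polar_body_def inner_commute[of _ z])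
    qed
  qed
qed

lemma symmetric_body_polar: "symmetric_body T"
proof
  have sym: "- p \<in> T" if "p \<in> T" for p
    using that uminus_mem by (fastforce simp: polar_body_def)
  show "centrally_symmetric T"
    unfolding centrally_symmetric_def using sym by (auto simp: image_iff) (metis minus_minus sym)
  have eq: "T = (\<Inter>x\<in>K. {p. x \<bullet> p \<le> 1})"
    by (auto simp: polar_body_def inner_commute)
  have "closed T" unfolding eq by (intro closed_INT ballI closed_halfspace_le)
  moreover have "convex T" unfolding eq by (intro convex_INT convex_halfspace_le)
  moreover have "bounded T"
  proof -
    obtain e where e: "e > 0" "cball 0 e \<subseteq> K"
      using zero_interior by (auto simp: mem_interior_cball)
    have "norm p \<le> 1 / e" if p: "p \<in> T" for p
    proof (cases "p = 0")
      case False
      have "p \<bullet> ((e / norm p) *\<^sub>R p) \<le> 1"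
        using e False by (intro polar_le_one[OF p] subsetD[OF e(2)]) auto
      then show ?thesis using False e(1)
        by (simp add: dot_square_norm field_simps power2_eq_square)
    qed (use e in auto)
    then show ?thesis by (auto simp: bounded_iff)
  qed
  moreover have "0 \<in> interior T"
  proof -
    obtain R where R: "R > 0" "\<And>x. x \<in> K \<Longrightarrow> norm x \<le> R"
      using compact_imp_bounded[OF compact_K] by (auto simp: bounded_pos)
    have "p \<in> T" if "norm p \<le> 1 / R" for p
    proof -
      have "p \<bullet> x \<le> 1" if "x \<in> K" for x
      proof -
        have "p \<bullet> x \<le> norm p * norm x" by (rule norm_cauchy_schwarz)
        also have "\<dots> \<le> (1 / R) * R"
          using R that \<open>norm p \<le> 1 / R\<close> by (intro mult_mono) auto
        finally show ?thesis using R(1) by simp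
      qed
      then show ?thesis by (simp add: polar_body_def)
    qed
    then have "cball 0 (1 / R) \<subseteq> T" by auto
    moreover have "1 / R > 0" using R by simp
    ultimately show ?thesis unfolding mem_interior_cball by blast
  qed
  ultimately show "convex_body T"
    by (auto simp: convex_body_def compact_eq_bounded_closed)
qed

text \<open>This is the duality on which all later estimates rest. The separation lemma shows that any
  positive \<open>r\<close> exceeding all products \<open>p \<bullet> x\<close> dilates \<open>K\<close> enough to contain \<open>x\<close>.\<close>

lemma support_gauge: "support_function T g"
  unfolding support_function_def
proof (intro allI conjI ballI)
  fix x :: 'a
  let ?R = "{r. r > 0 \<and> x \<in> (\<lambda>y. r *\<^sub>R y) ` K}"
  have mem: "r \<in> ?R" if r: "r > 0" and x: "\<And>p. p \<in> T \<Longrightarrow> p \<bullet> x < r" for r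
  proof -
    have "(1/r) *\<^sub>R x \<in> K"
    proof (rule ccontr)
      assume "(1/r) *\<^sub>R x \<notin> K"
      then obtain p where "p \<in> T" "p \<bullet> ((1/r) *\<^sub>R x) > 1" by (rule polar_separation)
      then show False using x[of p] r by (simp add: field_simps)
    qed
    then show ?thesis using r by (auto simp: image_iff intro!: bexI[of _ "(1/r) *\<^sub>R x"])
  qed
  have T: "compact T" using symmetric_body.compact_K[OF symmetric_body_polar] .
  moreover have "continuous_on T (\<lambda>p. p \<bullet> x)" by (intro continuous_intros)
  ultimately obtain p0 where p0: "p0 \<in> T" "\<And>p. p \<in> T \<Longrightarrow> p \<bullet> x \<le> p0 \<bullet> x"
    using continuous_attains_sup[of T "\<lambda>p. p \<bullet> x"] zero_mem_polar by auto
  have p0_ge: "p0 \<bullet> x \<ge> 0" using p0(2)[OF zero_mem_polar] by simp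
  have "p0 \<bullet> x + 1 \<in> ?R"
    using p0_ge by (intro mem) (auto intro: le_less_trans[OF p0(2)])
  then have ne: "?R \<noteq> {}" by blast
  have lower: "p \<bullet> x \<le> g x" if p: "p \<in> T" for p
    unfolding gauge_fun_def
  proof (rule cInf_greatest[OF ne])
    fix r assume "r \<in> ?R"
    then obtain y where "r > 0" "y \<in> K" "x = r *\<^sub>R y" by auto
    then show "p \<bullet> x \<le> r" using polar_le_one[OF p, of y] by (simp add: mult_left_le)
  qed
  then show "\<And>p. p \<in> T \<Longrightarrow> p \<bullet> x \<le> g x" .
  \<comment> \<open>the maximum \<open>p0 \<bullet> x\<close> may be 0, which is not an admissible dilation factor, hence the \<open>e\<close>\<close>
  have "g x \<le> p0 \<bullet> x"
  proof (rule field_le_epsilon)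
    fix e :: real assume e: "e > 0"
    have "p0 \<bullet> x + e \<in> ?R" using p0(2) p0_ge e by (intro mem) force+
    then show "g x \<le> p0 \<bullet> x + e"
      unfolding gauge_fun_def by (intro cInf_lower) (auto intro!: bdd_belowI[of _ 0])
  qed
  then show "\<exists>p\<in>T. p \<bullet> x = g x" using lower[OF p0(1)] p0(1) by (intro bexI[of _ p0]) auto
qed

lemma support_gauge_polar: "support_function K (gauge_fun T)"
  using symmetric_body.support_gauge[OF symmetric_body_polar] by (simp add: bipolar)

lemma inner_le_gauge: "p \<in> T \<Longrightarrow> p \<bullet> x \<le> g x"
  using support_functionD[OF support_gauge] .

lemma gauge_norming:
  obtains p where "p \<in> T" "p \<bullet> x = g x"
  using support_functionE[OF support_gauge] .

lemma gauge_le_iff: "g x \<le> c \<longleftrightarrow> (\<forall>p\<in>T. p \<bullet> x \<le> c)"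
  by (metis gauge_norming inner_le_gauge order_trans)

lemma gauge_nonneg: "g x \<ge> 0"
  using inner_le_gauge[OF zero_mem_polar, of x] by simp

lemma gauge_triangle: "g (x + y) \<le> g x + g y"
  unfolding gauge_le_iff by (auto simp: inner_add_right intro!: add_mono inner_le_gauge)

lemma gauge_uminus: "g (- x) = g x"
proof -
  have "g (- x) \<le> g x" for x
    unfolding gauge_le_iff
    by (metis inner_le_gauge inner_minus_left inner_minus_right symmetric_body.uminus_mem symmetric_body_polar)
  from this[of x] this[of "- x"] show ?thesis by simp
qed

lemma gauge_minus_commute: "g (x - y) = g (y - x)"
  using gauge_uminus[of "x - y"] by simp

lemma gauge_scale: 
  assumes "c \<ge> 0" shows "g (c *\<^sub>R x) = c * g x"
proof (rule antisym)
  show "g (c *\<^sub>R x) \<le> c * g x"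
    unfolding gauge_le_iff using assms by (auto intro!: mult_left_mono inner_le_gauge)
  obtain p where "p \<in> T" "p \<bullet> x = g x" by (rule gauge_norming)
  then show "c * g x \<le> g (c *\<^sub>R x)" using inner_le_gauge[of p "c *\<^sub>R x"] by simp
qed

lemma gauge_scale_abs: "g (c *\<^sub>R x) = \<bar>c\<bar> * g x"
  using gauge_scale[of "\<bar>c\<bar>" x] gauge_uminus[of "c *\<^sub>R x"] by (cases "c \<ge> 0") auto

lemma gauge_zero [simp]: "g 0 = 0"
  using gauge_scale[of 0 0] by simp

lemma gauge_eq_0_iff: "g x = 0 \<longleftrightarrow> x = 0"
proof
  assume g: "g x = 0"
  obtain e where e: "e > 0" "cball 0 e \<subseteq> T"
    using symmetric_body.zero_interior[OF symmetric_body_polar] by (auto simp: mem_interior_cball)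
  show "x = 0"
  proof (rule ccontr)
    assume x: "x \<noteq> 0"
    have "(e / norm x) *\<^sub>R x \<in> T" using e x by (intro subsetD[OF e(2)]) auto
    from inner_le_gauge[OF this, of x] show False
      using x e(1) g by (simp add: mult_le_0_iff divide_le_0_iff inner_gt_zero_iff flip: not_less)
  qed
qed simp

lemma mem_iff_gauge: "x \<in> K \<longleftrightarrow> g x \<le> 1"
  by (subst bipolar[symmetric]) (auto simp: gauge_le_iff polar_body_def inner_commute)

lemma interior_iff_gauge: "x \<in> interior K \<longleftrightarrow> g x < 1"
proof
  assume "x \<in> interior K"
  then obtain e where e: "e > 0" "cball x e \<subseteq> K" by (auto simp: mem_interior_cball)
  show "g x < 1"
  proof (cases "x = 0")
    case False
    define c where "c = 1 + e / norm x"
    have c: "c > 1" using e False by (simp add: c_def)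
    have "norm (x - c *\<^sub>R x) = (e / norm x) * norm x"
      using e False by (simp add: c_def algebra_simps)
    then have "c *\<^sub>R x \<in> K"
      using e False by (intro subsetD[OF e(2)]) (simp add: dist_norm)
    then have "c * g x \<le> 1" using c by (simp add: mem_iff_gauge gauge_scale)
    show ?thesis
    proof (rule ccontr)
      assume "\<not> g x < 1"
      then have "c * 1 \<le> c * g x" using c by (intro mult_left_mono) auto
      then show False using \<open>c * g x \<le> 1\<close> c by linarith
    qed
  qed simp
next
  assume gx: "g x < 1"
  obtain c where c: "g x < c" "c < 1" using dense[OF gx] by blast
  have c0: "c > 0" using c gauge_nonneg[of x] by linarith
  have "(1/c) *\<^sub>R x \<in> K"
    using c c0 by (simp add: mem_iff_gauge gauge_scale)
  then have "(1/c) *\<^sub>R x - (1 - c) *\<^sub>R ((1/c) *\<^sub>R x - 0) \<in> interior K"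
    using c c0 zero_interior by (intro mem_interior_convex_shrink convex_K) auto
  moreover have "(1/c) *\<^sub>R x - (1 - c) *\<^sub>R ((1/c) *\<^sub>R x - 0) = x"
    using c0 by (simp flip: scaleR_left_diff_distrib) (simp add: field_simps)
  ultimately show "x \<in> interior K" by simp
qed

lemma frontier_iff_gauge: "x \<in> frontier K \<longleftrightarrow> g x = 1"
  using interior_iff_gauge[of x] mem_iff_gauge[of x] closed_K by (auto simp: frontier_def)

lemma frontier_polar_iff_gauge: "p \<in> frontier T \<longleftrightarrow> gauge_fun T p = 1"
  by (rule symmetric_body.frontier_iff_gauge[OF symmetric_body_polar])

end

section \<open>Normals of a smooth strictly convex body\<close>

lemma smooth_on_imp_GDERIV:
  fixes f :: "'a::euclidean_space \<Rightarrow> real"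
  assumes "smooth_on U f" "open U" "x \<in> U"
  obtains D where "GDERIV f x :> D"
proof -
  have "Ck_on (Suc 0) U f" using assms(1) unfolding smooth_on_def by blast
  then obtain f' where f': "\<And>x. x \<in> U \<Longrightarrow> (f has_derivative f' x) (at x within U)"
    by auto
  then have der: "(f has_derivative f' x) (at x)"
    using assms at_within_open by metis
  then interpret bounded_linear "f' x" by (rule has_derivative_bounded_linear)
  have "f' x v = v \<bullet> (\<Sum>b\<in>Basis. f' x b *\<^sub>R b)" for v
  proof -
    have "f' x v = f' x (\<Sum>b\<in>Basis. (v \<bullet> b) *\<^sub>R b)" by (simp add: euclidean_representation)
    also have "\<dots> = (\<Sum>b\<in>Basis. (v \<bullet> b) * f' x b)" by (simp add: sum scaleR)
    also have "\<dots> = v \<bullet> (\<Sum>b\<in>Basis. f' x b *\<^sub>R b)" by (simp add: inner_sum_right mult.commute)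
    finally show ?thesis .
  qed
  then have "f' x = (\<lambda>v. v \<bullet> (\<Sum>b\<in>Basis. f' x b *\<^sub>R b))" by blast
  then show ?thesis using that der unfolding gderiv_def by metis
qed

text \<open>If a linear functional is maximal at \<open>x\<close> on a smooth level set, it does not increase along
  directions tangent to the level set. In place of the implicit function theorem: moving by \<open>t v\<close> and
  then by at most \<open>t k\<close> along the gradient \<open>D\<close> in either sense changes the sign of \<open>\<rho>\<close>, so the
  intermediate value theorem gives a point of the level set within \<open>t k\<close> (in units of \<open>D\<close>) of \<open>x + t v\<close>, for
  \<open>k\<close> as small as desired.\<close>

lemma support_nonpos_on_tangent:
  fixes \<rho> :: "'a::euclidean_space \<Rightarrow> real"
  assumes U: "open U" "x \<in> U" and smooth: "smooth_on U \<rho>"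
    and D: "GDERIV \<rho> x :> D" "D \<noteq> 0" and zero: "\<rho> x = 0"
    and below: "\<And>y. y \<in> U \<Longrightarrow> \<rho> y = 0 \<Longrightarrow> p \<bullet> y \<le> p \<bullet> x"
    and v: "D \<bullet> v = 0"
  shows "p \<bullet> v \<le> 0"
proof (rule field_le_epsilon)
  fix e :: real assume e: "e > 0"
  define k where "k = e / (\<bar>p \<bullet> D\<bar> + 1)"
  have k: "k > 0" using e by (simp add: k_def)
  have kD: "k * \<bar>p \<bullet> D\<bar> \<le> e"
  proof -
    have "k * \<bar>p \<bullet> D\<bar> \<le> k * (\<bar>p \<bullet> D\<bar> + 1)" using k by simp
    also have "\<dots> = e" by (simp add: k_def)
    finally show ?thesis .
  qed
  obtain r where r: "r > 0" "ball x r \<subseteq> U" using U by (auto simp: open_contains_ball)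
  have cont: "continuous_on U \<rho>"
    using smooth unfolding smooth_on_def by (metis Ck_on.simps(1))
  define N where "N = norm v + k * norm D + 1"
  have N: "N > 0" using k by (simp add: N_def add_nonneg_pos)
  \<comment> \<open>so small that the error over a step of length at most \<open>t * N\<close> is half of the change \<open>t * k * (D \<bullet> D)\<close> along \<open>D\<close>\<close>
  define \<delta> where "\<delta> = k * (D \<bullet> D) / (2 * N)"
  have \<delta>: "\<delta> > 0" using k D(2) N by (simp add: \<delta>_def)
  obtain d where d: "d > 0"
    "\<And>y. norm (y - x) < d \<Longrightarrow> norm (\<rho> y - \<rho> x - (y - x) \<bullet> D) \<le> \<delta> * norm (y - x)"
    using D(1) \<delta> unfolding gderiv_def has_derivative_at_alt by blast
  define t where "t = min r d / (2 * N)"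
  have t: "t > 0" "t * N < r" "t * N < d"
    using r(1) d(1) N by (auto simp: t_def min_def)
  define y where "y s = x + t *\<^sub>R v + (t * s) *\<^sub>R D" for s
  have step: "norm (y s - x) \<le> t * N" if "\<bar>s\<bar> \<le> k" for s
  proof -
    have "norm (y s - x) \<le> norm (t *\<^sub>R v) + norm ((t * s) *\<^sub>R D)"
      unfolding y_def by (metis add_diff_cancel_left' add.assoc norm_triangle_ineq)
    also have "\<dots> = t * (norm v + \<bar>s\<bar> * norm D)"
      using t by (simp add: abs_mult algebra_simps)
    also have "\<dots> \<le> t * N"
      unfolding N_def using mult_right_mono[OF that norm_ge_zero[of D]] t by (intro mult_left_mono) auto
    finally show ?thesis .
  qed
  have yU: "y s \<in> U" if "\<bar>s\<bar> \<le> k" for s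
    using step[OF that] t r(2) by (auto simp: dist_norm norm_minus_commute intro!: subsetD[OF r(2)])
  have dev: "\<bar>\<rho> (y s) - t * s * (D \<bullet> D)\<bar> \<le> t * k * (D \<bullet> D) / 2" if "\<bar>s\<bar> \<le> k" for s
  proof -
    have "(y s - x) \<bullet> D = t * s * (D \<bullet> D)"
      using v by (simp add: y_def algebra_simps inner_add_left inner_commute[of v])
    then have "\<bar>\<rho> (y s) - t * s * (D \<bullet> D)\<bar> \<le> \<delta> * norm (y s - x)"
      using d(2)[of "y s"] step[OF that] t zero by simp
    also have "\<dots> \<le> \<delta> * (t * N)" using step[OF that] \<delta> by (intro mult_left_mono) auto
    also have "\<dots> = t * k * (D \<bullet> D) / 2" using N by (simp add: \<delta>_def field_simps)
    finally show ?thesis .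
  qed
  define M where "M = t * k * (D \<bullet> D)"
  have M: "M > 0" using t k D(2) by (simp add: M_def)
  have ends: "\<bar>\<rho> (y (- k)) + M\<bar> \<le> M / 2" "\<bar>\<rho> (y k) - M\<bar> \<le> M / 2"
    using dev[of "- k"] dev[of k] k by (simp_all add: M_def)
  have "\<exists>s\<ge>- k. s \<le> k \<and> \<rho> (y s) = 0"
  proof (rule IVT')
    show "\<rho> (y (- k)) \<le> 0" using ends(1) M by arith
    show "0 \<le> \<rho> (y k)" using ends(2) M by arith
    show "- k \<le> k" using k by simp
    show "continuous_on {- k..k} (\<lambda>s. \<rho> (y s))"
      unfolding y_def using yU
      by (intro continuous_on_compose2[OF cont] continuous_intros) (auto simp: y_def abs_le_iff)
  qed
  then obtain s where s: "\<bar>s\<bar> \<le> k" "\<rho> (y s) = 0" by (auto simp: abs_le_iff minus_le_iff)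
  have "p \<bullet> y s \<le> p \<bullet> x" using below yU s by blast
  then have "t * (p \<bullet> v + s * (p \<bullet> D)) \<le> 0" by (simp add: y_def algebra_simps inner_add_right)
  then have "p \<bullet> v \<le> - s * (p \<bullet> D)" using t(1) by (simp add: mult_le_0_iff)
  also have "\<dots> \<le> \<bar>s\<bar> * \<bar>p \<bullet> D\<bar>" by (metis abs_ge_self abs_minus_cancel abs_mult)
  also have "\<dots> \<le> k * \<bar>p \<bullet> D\<bar>" using s by (intro mult_right_mono) auto
  finally show "p \<bullet> v \<le> 0 + e" using kD by simp
qed

locale smooth_strictly_convex_body = symmetric_body +
  assumes strict: "strictly_convex K" and smooth: "smooth_boundary K"
begin

lemma maximizer_unique:
  assumes "p \<in> T" "x \<in> K" "y \<in> K" "p \<bullet> x = 1" "p \<bullet> y = 1"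
  shows "x = y"
proof (rule ccontr)
  assume "x \<noteq> y"
  then have "midpoint x y \<in> open_segment x y" by simp
  then have "midpoint x y \<in> interior K"
    using strict assms unfolding strictly_convex_def by blast
  then have "g (midpoint x y) < 1" by (simp add: interior_iff_gauge)
  moreover have "p \<bullet> midpoint x y = 1"
    using assms by (simp add: midpoint_def inner_add_right)
  ultimately show False using inner_le_gauge[OF assms(1), of "midpoint x y"] by simp
qed

text \<open>Every normal vanishes on the tangent hyperplane of the boundary at \<open>x\<close>, so normals at \<open>x\<close> are
  multiples of each other.\<close>

lemma support_normal_unique:
  assumes x: "x \<in> frontier K" and p: "p \<in> T" "p \<bullet> x = 1" and r: "r \<in> T" "r \<bullet> x = 1"
  shows "p = r"
proof -
  obtain U and \<rho> :: "'a \<Rightarrow> real" where U: "open U" "x \<in> U" "smooth_on U \<rho>"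
      "\<And>y. y \<in> U \<Longrightarrow> grad \<rho> y \<noteq> 0" and fr: "frontier K \<inter> U = {y\<in>U. \<rho> y = 0}"
    using smooth x unfolding smooth_boundary_def by metis
  obtain D where D: "GDERIV \<rho> x :> D" using smooth_on_imp_GDERIV U by metis
  have D0: "D \<noteq> 0" using U(2,4) grad_eqI[OF D] by auto
  have zero: "\<rho> x = 0" using fr x U by auto
  have tangent: "s \<bullet> v = 0" if s: "s \<in> T" "s \<bullet> x = 1" and v: "D \<bullet> v = 0" for s v
  proof -
    have "y \<in> K" if "y \<in> U" "\<rho> y = 0" for y
      using fr that frontier_subset_closed[OF closed_K] by auto
    then have "s \<bullet> y \<le> s \<bullet> x" if "y \<in> U" "\<rho> y = 0" for y
      using polar_le_one[OF s(1)] s(2) that by simp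
    then have "s \<bullet> w \<le> 0" if "D \<bullet> w = 0" for w
      using support_nonpos_on_tangent[OF U(1-3) D D0 zero] that by blast
    from this[of v] this[of "- v"] v show ?thesis by simp
  qed
  have Dx: "D \<bullet> x \<noteq> 0" using tangent[OF p, of x] p(2) by auto
  \<comment> \<open>both normals agree on \<open>x\<close> and on the hyperplane orthogonal to \<open>D\<close>, which together span\<close>
  have "p \<bullet> w = r \<bullet> w" for w
  proof -
    define c where "c = (D \<bullet> w) / (D \<bullet> x)"
    have "D \<bullet> (w - c *\<^sub>R x) = 0" using Dx by (simp add: c_def inner_diff_right)
    from tangent[OF p this] tangent[OF r this] p(2) r(2) show ?thesis
      by (simp add: inner_diff_right)
  qed
  then show "p = r" by (metis vector_eq_rdot inner_commute)
qed

lemma grad_gauge_eq: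
  assumes "x \<in> frontier K" "p \<in> T" "p \<bullet> x = 1"
  shows "grad g x = p"
proof (rule grad_eqI, rule GDERIV_support_function[OF support_gauge])
  show "compact T" by (rule symmetric_body.compact_K[OF symmetric_body_polar])
  show "p \<bullet> x = g x" using assms frontier_iff_gauge by simp
  show "c' = p" if "c' \<in> T" "c' \<bullet> x = g x" for c'
    using that assms support_normal_unique by (simp add: frontier_iff_gauge)
qed (use assms in auto)

lemma grad_gauge_polar_eq:
  assumes "p \<in> frontier T" "x \<in> K" "p \<bullet> x = 1"
  shows "grad (gauge_fun T) p = x"
proof (rule grad_eqI, rule GDERIV_support_function[OF support_gauge_polar compact_K])
  have p: "p \<in> T" 
    using assms(1) frontier_subset_closed[OF symmetric_body.closed_K[OF symmetric_body_polar]] by blast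
  show "x \<bullet> p = gauge_fun T p" using assms frontier_polar_iff_gauge by (simp add: inner_commute)
  show "c' = x" if "c' \<in> K" "c' \<bullet> p = gauge_fun T p" for c'
    using that assms p maximizer_unique by (simp add: frontier_polar_iff_gauge inner_commute)
qed (use assms in auto)

lemma grad_gauge_normal:
  assumes "x \<in> frontier K"
  shows "grad g x \<in> T" "grad g x \<bullet> x = 1"
proof -
  obtain p where "p \<in> T" "p \<bullet> x = g x" by (rule gauge_norming)
  then show "grad g x \<in> T" "grad g x \<bullet> x = 1"
    using assms grad_gauge_eq[of x p] by (simp_all add: frontier_iff_gauge)
qed

lemma grad_gauge_polar_normal:
  assumes "p \<in> frontier T"
  shows "grad (gauge_fun T) p \<in> K" "p \<bullet> grad (gauge_fun T) p = 1"
proof -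
  obtain x where "x \<in> K" "x \<bullet> p = gauge_fun T p" using support_functionE[OF support_gauge_polar] .
  then show "grad (gauge_fun T) p \<in> K" "p \<bullet> grad (gauge_fun T) p = 1"
    using assms grad_gauge_polar_eq[of p x] by (simp_all add: frontier_polar_iff_gauge inner_commute)
qed

lemma frontier_product:
  "(x, p) \<in> frontier (K \<times> T) \<longleftrightarrow> (x \<in> frontier K \<and> p \<in> T) \<or> (x \<in> K \<and> p \<in> frontier T)"
  using closed_K symmetric_body.closed_K[OF symmetric_body_polar]
  by (auto simp: frontier_def interior_Times closure_Times)

end

section \<open>The back-and-forth orbits\<close>

text \<open>The closed polygon with vertices \<open>P j\<close> that spends a quarter of the period on each edge. Indexing by
  the integers, with \<open>P\<close> of period 4, makes all vertices alike: the starting time needs no separate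
  treatment.\<close>

definition polygon :: "(int \<Rightarrow> 'a::real_vector) \<Rightarrow> real \<Rightarrow> 'a" where
  "polygon P t = P \<lfloor>4 * t\<rfloor> + (4 * t - \<lfloor>4 * t\<rfloor>) *\<^sub>R (P (\<lfloor>4 * t\<rfloor> + 1) - P \<lfloor>4 * t\<rfloor>)"

lemma polygon_edge:
  assumes "t \<in> {of_int j / 4..of_int (j + 1) / 4}"
  shows "polygon P t = P j + (4 * t - j) *\<^sub>R (P (j + 1) - P j)"
proof (cases "t = of_int (j + 1) / 4")
  case True
  then have "4 * t = of_int (j + 1)" by simp
  then show ?thesis unfolding polygon_def by simp
next
  case False
  then have "\<lfloor>4 * t\<rfloor> = j" using assms by (simp add: floor_eq_iff)
  then show ?thesis by (simp add: polygon_def)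
qed

lemma polygon_vertex: "polygon P (of_int j / 4) = P j"
  by (simp add: polygon_def)

lemma polygon_period:
  assumes "\<And>j. P (j + 4) = P j"
  shows "polygon P (t + 1) = polygon P t"
proof -
  have *: "\<lfloor>4 * (t + 1)\<rfloor> = \<lfloor>4 * t\<rfloor> + 4" by (simp add: algebra_simps floor_add_int)
  have "P (\<lfloor>4 * t\<rfloor> + 4 + 1) = P (\<lfloor>4 * t\<rfloor> + 1)" using assms[of "\<lfloor>4 * t\<rfloor> + 1"] by (simp add: add_ac)
  then show ?thesis unfolding polygon_def * by (simp add: assms)
qed

lemma affine_edge_derivative:
  fixes P :: "int \<Rightarrow> 'a::real_normed_vector"
  shows "((\<lambda>t. P j + (4 * t - of_int j) *\<^sub>R (P (j + 1) - P j)) has_vector_derivative 4 *\<^sub>R (P (j + 1) - P j)) (at t within S)"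
  by (auto intro!: derivative_eq_intros)

lemma polygon_has_derivative_edge:
  fixes P :: "int \<Rightarrow> 'a::real_normed_vector"
  assumes "t \<in> {of_int j / 4..of_int (j + 1) / 4}"
  shows "(polygon P has_vector_derivative 4 *\<^sub>R (P (j + 1) - P j)) (at t within {of_int j / 4..of_int (j + 1) / 4})"
  by (rule has_vector_derivative_transform[OF assms _ affine_edge_derivative]) (rule polygon_edge)

lemma polygon_has_derivative_interior:
  fixes P :: "int \<Rightarrow> 'a::real_normed_vector"
  assumes "t \<in> {of_int j / 4<..<of_int (j + 1) / 4}"
  shows "(polygon P has_vector_derivative 4 *\<^sub>R (P (j + 1) - P j)) (at t)"
  using polygon_has_derivative_edge[of t j P] assms at_within_Icc_at[of "of_int j / 4" t "of_int (j + 1) / 4"] by auto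

lemma polygon_has_derivative_right:
  fixes P :: "int \<Rightarrow> 'a::real_normed_vector"
  shows "(polygon P has_vector_derivative 4 *\<^sub>R (P (j + 1) - P j)) (at_right (of_int j / 4))"
  using polygon_has_derivative_edge[of "of_int j / 4" j P]
    at_within_Icc_at_right[of "of_int j / 4 :: real" "of_int (j + 1) / 4"] by auto

lemma polygon_has_derivative_left:
  fixes P :: "int \<Rightarrow> 'a::real_normed_vector"
  shows "(polygon P has_vector_derivative 4 *\<^sub>R (P j - P (j - 1))) (at_left (of_int j / 4))"
  using polygon_has_derivative_edge[of "of_int j / 4" "j - 1" P]
    at_within_Icc_at_left[of "of_int (j - 1) / 4 :: real" "of_int j / 4"] by auto

lemma quarter_cases:
  fixes t :: real
  obtains j :: int where "t = of_int j / 4" | j :: int where "t \<in> {of_int j / 4<..<of_int (j + 1) / 4}"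
proof -
  define j where "j = \<lfloor>4 * t\<rfloor>"
  have j: "of_int j \<le> 4 * t" "4 * t < of_int j + 1" unfolding j_def by linarith+
  show ?thesis
  proof (cases "4 * t = of_int j")
    case True
    then show ?thesis by (intro that(1)[of j]) simp
  next
    case False
    then show ?thesis using j by (intro that(2)[of j]) simp
  qed
qed

lemma continuous_polygon:
  fixes P :: "int \<Rightarrow> 'a::real_normed_vector"
  shows "continuous_on UNIV (polygon P)"
proof -
  have "isCont (polygon P) t" for t
  proof (cases t rule: quarter_cases)
    case (1 j)
    then show ?thesis
      unfolding 1 continuous_at_split
      using polygon_has_derivative_left[of P j] polygon_has_derivative_right[of P j]
      by (blast intro: has_vector_derivative_continuous)
  next
    case (2 j)
    then show ?thesis using polygon_has_derivative_interior has_vector_derivative_continuous by blast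
  qed
  then show ?thesis by (simp add: continuous_on_eq_continuous_at)
qed

lemma Ck_on_const: "Ck_on k S (\<lambda>_. c)"
proof (induction k arbitrary: c)
  case (Suc k)
  show ?case using Suc[of 0] by (auto intro!: exI[of _ "\<lambda>_ _. 0"])
qed simp

lemma smooth_on_affine:
  fixes c :: "real \<Rightarrow> 'b::euclidean_space"
  assumes "\<And>t. t \<in> S \<Longrightarrow> (c has_vector_derivative v) (at t within S)"
  shows "smooth_on S c"
  unfolding smooth_on_def
proof
  fix k
  show "Ck_on k S c"
  proof (cases k)
    case 0
    then show ?thesis
      using assms has_vector_derivative_continuous continuous_on_eq_continuous_within by fastforce
  next
    case (Suc l)
    then show ?thesis
      using assms by (auto simp: has_vector_derivative_def Ck_on_const intro!: exI[of _ "\<lambda>_ h. h *\<^sub>R v"])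
  qed
qed

lemma piecewise_smooth_polygon:
  fixes P :: "int \<Rightarrow> 'a::euclidean_space"
  assumes "\<And>j. P (j + 4) = P j"
  shows "piecewise_smooth_closed_curve (polygon P)"
  unfolding piecewise_smooth_closed_curve_def closed_curve_def
proof (intro conjI exI[of _ "(\<lambda>j::int. of_int j / 4) ` {0..4}"] allI impI continuous_polygon polygon_period assms)
  fix a b :: real
  assume ab: "0 \<le> a \<and> a < b \<and> b \<le> 1 \<and> {a<..<b} \<inter> (\<lambda>j::int. of_int j / 4) ` {0..4} = {}"
  define j where "j = \<lfloor>4 * a\<rfloor>"
  have j: "of_int j \<le> 4 * a" "4 * a < of_int j + 1" unfolding j_def by linarith+
  have "0 \<le> j" "j + 1 \<le> 4" using ab j by linarith+
  have "b \<le> of_int (j + 1) / 4"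
  proof (rule ccontr)
    assume "\<not> ?thesis"
    then have "of_int (j + 1) / 4 \<in> {a<..<b}" using j by auto
    then show False using ab \<open>0 \<le> j\<close> \<open>j + 1 \<le> 4\<close> by fastforce
  qed
  then have sub: "{a..b} \<subseteq> {of_int j / 4..of_int (j + 1) / 4}" using j by auto
  show "smooth_on {a..b} (polygon P)"
  proof (rule smooth_on_affine)
    fix t assume "t \<in> {a..b}"
    then have "t \<in> {of_int j / 4..of_int (j + 1) / 4}" using sub by blast
    then show "(polygon P has_vector_derivative 4 *\<^sub>R (P (j + 1) - P j)) (at t within {a..b})"
      using sub by (intro has_vector_derivative_within_subset[OF polygon_has_derivative_edge])
  qed
qed simp

lemma polygon_length:
  fixes P :: "int \<Rightarrow> 'a::euclidean_space"
  shows "((\<lambda>t. gauge_fun K (vector_derivative (polygon P) (at t))) has_integral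
    (\<Sum>j\<in>{0,1,2,3}. gauge_fun K (4 *\<^sub>R (P (j + 1) - P j)) / 4)) {0..1}"
proof -
  let ?f = "\<lambda>t. gauge_fun K (vector_derivative (polygon P) (at t))"
  have edge: "(?f has_integral gauge_fun K (4 *\<^sub>R (P (j + 1) - P j)) / 4)
      {of_int j / 4..of_int (j + 1) / 4}" for j :: int
  proof (rule has_integral_spike_finite)
    show "((\<lambda>t. gauge_fun K (4 *\<^sub>R (P (j + 1) - P j))) has_integral
        gauge_fun K (4 *\<^sub>R (P (j + 1) - P j)) / 4) {of_int j / 4..of_int (j + 1) / 4 :: real}"
    proof -
      have "measure lborel {of_int j / 4..of_int (j + 1) / 4 :: real} = 1 / 4" by (simp add: add_divide_distrib)
      then show ?thesis
        using has_integral_const_real[of "gauge_fun K (4 *\<^sub>R (P (j + 1) - P j))" "of_int j / 4" "of_int (j + 1) / 4"]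
        by (simp only: real_scaleR_def) (simp only: mult_1 times_divide_eq_left)
    qed
    show "finite {of_int j / 4, of_int (j + 1) / 4 :: real}" by simp
    show "?f t = gauge_fun K (4 *\<^sub>R (P (j + 1) - P j))"
      if "t \<in> {of_int j / 4..of_int (j + 1) / 4} - {of_int j / 4, of_int (j + 1) / 4}" for t
      using that polygon_has_derivative_interior[of t j P] by (simp add: vector_derivative_at)
  qed
  let ?e = "\<lambda>j. gauge_fun K (4 *\<^sub>R (P (j + 1) - P j)) / 4"
  have "(?f has_integral ?e 0 + ?e 1) {0..1/2}"
    by (rule has_integral_combine[of 0 "1/4"]) (use edge[of 0] edge[of 1] in auto)
  moreover have "(?f has_integral ?e 2 + ?e 3) {1/2..1}"
    by (rule has_integral_combine[of "1/2" "3/4"]) (use edge[of 2] edge[of 3] in auto)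
  ultimately have "(?f has_integral (?e 0 + ?e 1) + (?e 2 + ?e 3)) {0..1}"
    by (intro has_integral_combine[of 0 "1/2" 1]) auto
  then show ?thesis by (simp add: add.assoc)
qed

text \<open>The four points \<open>(\<plusminus>x, \<plusminus>r)\<close> at which position and momentum take turns, in the order in which the
  billiard motion visits them: first \<open>x\<close> travels to \<open>- x\<close> with momentum \<open>r\<close>, then the momentum changes
  to \<open>- r\<close> at \<open>- x\<close>, and so back.\<close>

definition vertex :: "'a::uminus \<Rightarrow> 'a \<Rightarrow> int \<Rightarrow> 'a \<times> 'a" where
  "vertex x r j = (if j mod 4 \<in> {0, 3} then x else - x, if j mod 4 \<in> {0, 1} then r else - r)"

lemma vertex_mod_cases:
  obtains "j mod 4 = 0" "(j + 1) mod 4 = 1" "(j - 1) mod 4 = 3"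
    | "j mod 4 = 1" "(j + 1) mod 4 = 2" "(j - 1) mod 4 = 0"
    | "j mod 4 = 2" "(j + 1) mod 4 = 3" "(j - 1) mod 4 = 1"
    | "j mod 4 = (3::int)" "(j + 1) mod 4 = 0" "(j - 1) mod 4 = 2"
proof -
  have "(j + 1) mod 4 = (j mod 4 + 1) mod 4" "(j - 1) mod 4 = (j mod 4 - 1) mod 4"
    by (simp_all only: mod_add_left_eq mod_diff_left_eq)
  note step = this
  have "0 \<le> j mod 4" "j mod 4 < 4" by simp_all
  then consider "j mod 4 = 0" | "j mod 4 = 1" | "j mod 4 = 2" | "j mod 4 = 3" by linarith
  then show ?thesis
  proof cases
    case 1 show ?thesis by (rule that(1)) (simp_all only: 1 step, simp_all)
  next
    case 2 show ?thesis by (rule that(2)) (simp_all only: 2 step, simp_all)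
  next
    case 3 show ?thesis by (rule that(3)) (simp_all only: 3 step, simp_all)
  next
    case 4 show ?thesis by (rule that(4)) (simp_all only: 4 step, simp_all)
  qed
qed

context smooth_strictly_convex_body
begin

text \<open>The gradients at \<open>x\<close> and \<open>- x\<close> are \<open>r\<close> and \<open>- r\<close>, and vice versa, so every edge follows the
  billiard field. The factor 8 is forced: within one period, position and momentum both travel twice a
  distance 2, in their respective norms and at the same constant speed.\<close>

lemma two_bounce_trajectory:
  assumes x: "x \<in> frontier K" and r: "r \<in> T" "r \<bullet> x = 1"
  shows "closed_KT_billiard_trajectory K T (polygon (vertex x r))"
proof -
  have rT: "r \<in> frontier T"
  proof -
    have "gauge_fun T r = 1"
    proof (rule antisym)
      show "gauge_fun T r \<le> 1"
        using r(1) symmetric_body.mem_iff_gauge[OF symmetric_body_polar] by blast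
      have "x \<in> K" using x frontier_subset_closed[OF closed_K] by blast
      then show "1 \<le> gauge_fun T r"
        using support_functionD[OF support_gauge_polar, of x r] r(2) by (simp add: inner_commute)
    qed
    then show ?thesis by (simp add: frontier_polar_iff_gauge)
  qed
  have xK: "x \<in> K" using x frontier_subset_closed[OF closed_K] by blast
  have neg: "- x \<in> frontier K" "- x \<in> K" "- r \<in> frontier T" "- r \<in> T"
    using x rT xK r uminus_mem symmetric_body.uminus_mem[OF symmetric_body_polar]
    by (auto simp: frontier_iff_gauge frontier_polar_iff_gauge gauge_uminus
        symmetric_body.gauge_uminus[OF symmetric_body_polar])
  have grads: "grad g x = r" "grad g (- x) = - r" "grad (gauge_fun T) r = x" "grad (gauge_fun T) (- r) = - x"
    using x r rT xK neg by (auto intro!: grad_gauge_eq grad_gauge_polar_eq)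
  have inside: "c *\<^sub>R x \<in> interior K" "c *\<^sub>R r \<in> interior T" if "\<bar>c\<bar> < 1" for c
  proof -
    show "c *\<^sub>R x \<in> interior K"
      using x that by (simp add: interior_iff_gauge frontier_iff_gauge gauge_scale_abs)
    show "c *\<^sub>R r \<in> interior T"
      using rT that by (simp add: symmetric_body.interior_iff_gauge[OF symmetric_body_polar]
          symmetric_body.gauge_scale_abs[OF symmetric_body_polar] frontier_polar_iff_gauge)
  qed
  have double: "4 *\<^sub>R (- y - y) = - (8 *\<^sub>R y)" "4 *\<^sub>R (y + y) = 8 *\<^sub>R y" for y :: 'a
    using scaleR_left_distrib[of 4 4 y] by (simp_all add: algebra_simps)
  have on_edge: "polygon (vertex x r) t \<in> frontier (K \<times> T) \<and>
      polygon (vertex x r) t \<notin> frontier K \<times> frontier T \<and>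
      4 *\<^sub>R (vertex x r (j + 1) - vertex x r j) = 8 *\<^sub>R billiard_field K T (polygon (vertex x r) t)"
    if t: "t \<in> {of_int j / 4<..<of_int (j + 1) / 4}" for t j
  proof -
    \<comment> \<open>the moving component runs from its start through the multiples \<open>c\<close> of it, \<open>c\<close> falling from 1 to \<open>- 1\<close>\<close>
    define c where "c = 1 - 2 * (4 * t - of_int j)"
    have c: "\<bar>c\<bar> < 1" "\<bar>- c\<bar> < 1" using t by (auto simp: c_def abs_less_iff)
    note ins = inside[OF c(1)] inside[OF c(2)]
    have inK: "c *\<^sub>R x \<in> K" "(- c) *\<^sub>R x \<in> K" "c *\<^sub>R r \<in> T" "(- c) *\<^sub>R r \<in> T"
      using ins interior_subset by blast+
    have nf: "c *\<^sub>R x \<notin> frontier K" "(- c) *\<^sub>R x \<notin> frontier K" "c *\<^sub>R r \<notin> frontier T" "(- c) *\<^sub>R r \<notin> frontier T"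
      using ins by (auto simp: frontier_def)
    have nx: "x \<notin> interior K" "- x \<notin> interior K" using x neg by (auto simp: frontier_def)
    have "polygon (vertex x r) t = vertex x r j + ((1 - c) / 2) *\<^sub>R (vertex x r (j + 1) - vertex x r j)"
      using polygon_edge[of t j "vertex x r"] t by (simp add: c_def)
    then have "(j mod 4 = 0 \<longrightarrow> polygon (vertex x r) t = (c *\<^sub>R x, r)) \<and>
      (j mod 4 = 1 \<longrightarrow> polygon (vertex x r) t = (- x, c *\<^sub>R r)) \<and>
      (j mod 4 = 2 \<longrightarrow> polygon (vertex x r) t = ((- c) *\<^sub>R x, - r)) \<and>
      (j mod 4 = 3 \<longrightarrow> polygon (vertex x r) t = (x, (- c) *\<^sub>R r))"
      by (cases j rule: vertex_mod_cases)
        (auto simp: vertex_def algebra_simps add_divide_distrib diff_divide_distrib scaleR_2 simp flip: scaleR_add_left)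
    then show ?thesis
      using x neg rT r xK ins inK nf nx grads
      by (cases j rule: vertex_mod_cases)
        (auto simp: vertex_def frontier_product billiard_field_def double)
  qed
  show ?thesis
    unfolding closed_KT_billiard_trajectory_def
  proof (intro conjI allI impI exI[of _ "8::real"])
    have "vertex x r (j + 4) = vertex x r j" for j by (simp add: vertex_def)
    then show "piecewise_smooth_closed_curve (polygon (vertex x r))" by (rule piecewise_smooth_polygon)
    have corner: "vertex x r j \<in> frontier K \<times> frontier T" for j
      using x neg rT by (auto simp: vertex_def)
    fix t
    show "polygon (vertex x r) t \<in> frontier (K \<times> T)"
    proof (cases t rule: quarter_cases)
      case (1 j)
      then have "polygon (vertex x r) t = vertex x r j" by (simp only: polygon_vertex)
      then show ?thesis using corner[of j] r neg
        by (auto simp: vertex_def frontier_product split: if_splits)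
    qed (use on_edge in blast)
    show "(polygon (vertex x r) has_vector_derivative 8 *\<^sub>R billiard_field K T (polygon (vertex x r) t)) (at t)"
      if "polygon (vertex x r) t \<notin> frontier K \<times> frontier T"
    proof (cases t rule: quarter_cases)
      case (1 j)
      then have "polygon (vertex x r) t = vertex x r j" by (simp only: polygon_vertex)
      then show ?thesis using corner[of j] that by simp
    next
      case (2 j)
      then show ?thesis using polygon_has_derivative_interior[OF 2, of "vertex x r"] on_edge[OF 2] by simp
    qed
    assume corner_t: "polygon (vertex x r) t \<in> frontier K \<times> frontier T"
    then obtain j where j: "t = of_int j / 4" using on_edge by (cases t rule: quarter_cases) auto
    have cone: "4 *\<^sub>R (vertex x r (j + 1) - vertex x r j) \<in> billiard_cone K T (vertex x r j)"
      "4 *\<^sub>R (vertex x r j - vertex x r (j - 1)) \<in> billiard_cone K T (vertex x r j)"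
      unfolding billiard_cone_def
      by (cases j rule: vertex_mod_cases; force simp: vertex_def grads double
          intro: exI[of _ 8] exI[of _ 0])+
    then show "\<exists>v\<in>billiard_cone K T (polygon (vertex x r) t). (polygon (vertex x r) has_vector_derivative v) (at_left t)"
      "\<exists>v\<in>billiard_cone K T (polygon (vertex x r) t). (polygon (vertex x r) has_vector_derivative v) (at_right t)"
      using polygon_has_derivative_left[of "vertex x r" j] polygon_has_derivative_right[of "vertex x r" j]
      unfolding j polygon_vertex by blast+
  qed simp
qed

lemma two_bounce_length:
  assumes x: "x \<in> frontier K"
  shows "gauge_length K (fst \<circ> polygon (vertex x r)) = 4"
proof -
  have "fst \<circ> polygon (vertex x r) = polygon (fst \<circ> vertex x r)"
    by (simp add: fun_eq_iff polygon_def)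
  moreover have "(- x - x) = - (2 *\<^sub>R x)" "x + x = 2 *\<^sub>R x"
    by (simp_all add: scaleR_2)
  ultimately show ?thesis
    using integral_unique[OF polygon_length[of K "fst \<circ> vertex x r"]] x
    by (simp add: gauge_length_def vertex_def gauge_uminus gauge_scale frontier_iff_gauge)
qed

end

section \<open>Velocities of piecewise smooth closed curves\<close>

lemma interval_subdivision_induct:
  fixes lo hi :: real
  assumes "finite S" "lo \<le> hi"
    and join: "\<And>a b c. lo \<le> a \<Longrightarrow> a \<le> b \<Longrightarrow> b \<le> c \<Longrightarrow> c \<le> hi \<Longrightarrow> P a b \<Longrightarrow> P b c \<Longrightarrow> P a c"
    and avoid: "\<And>a b. lo \<le> a \<Longrightarrow> a \<le> b \<Longrightarrow> b \<le> hi \<Longrightarrow> {a<..<b} \<inter> S = {} \<Longrightarrow> P a b"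
  shows "P lo hi"
proof -
  have "P a b" if "lo \<le> a" "a \<le> b" "b \<le> hi" for a b
    using that
  proof (induction "card ({a<..<b} \<inter> S)" arbitrary: a b rule: less_induct)
    case less
    show ?case
    proof (cases "{a<..<b} \<inter> S = {}")
      case True
      then show ?thesis using avoid less.prems by blast
    next
      case False
      then obtain s where s: "a < s" "s < b" "s \<in> S" by auto
      have "card ({a<..<s} \<inter> S) < card ({a<..<b} \<inter> S)" "card ({s<..<b} \<inter> S) < card ({a<..<b} \<inter> S)"
        using s \<open>finite S\<close> by (auto intro!: psubset_card_mono)
      then have "P a s" "P s b" using less s by auto
      then show ?thesis using join[of a s b] less.prems s by auto
    qed
  qed
  then show ?thesis using \<open>lo \<le> hi\<close> by blast
qed

text \<open>The velocity of a piecewise smooth curve is defined off a finite set and integrable against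
  continuous functions. Together with continuity, this is all the regularity that the length
  estimates need; it names no breakpoints and so is preserved when intervals are joined.\<close>

definition integrable_velocity :: "(real \<Rightarrow> 'a::euclidean_space) \<Rightarrow> real \<Rightarrow> real \<Rightarrow> bool" where
  "integrable_velocity c a b \<longleftrightarrow> finite {t\<in>{a..b}. \<not> c differentiable (at t)} \<and>
     (\<forall>f. continuous_on UNIV f \<longrightarrow> (\<lambda>t. f t \<bullet> vector_derivative c (at t)) integrable_on {a..b})"

lemma integrable_velocity_join:
  assumes "integrable_velocity c a b" "integrable_velocity c b d" "a \<le> b" "b \<le> d"
  shows "integrable_velocity c a d"
proof -
  have "{t\<in>{a..d}. \<not> c differentiable (at t)} \<subseteq>
      {t\<in>{a..b}. \<not> c differentiable (at t)} \<union> {t\<in>{b..d}. \<not> c differentiable (at t)}"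
    by auto
  then have "finite {t\<in>{a..d}. \<not> c differentiable (at t)}"
    using assms finite_subset unfolding integrable_velocity_def by blast
  then show ?thesis
    using assms unfolding integrable_velocity_def by (auto intro: Henstock_Kurzweil_Integration.integrable_combine)
qed

lemma integrable_velocity_smooth:
  assumes smooth: "smooth_on {a..b} c" and "a < b"
  shows "integrable_velocity c a b"
proof -
  have "Ck_on (Suc 0) {a..b} c" using smooth unfolding smooth_on_def by blast
  then obtain c' where c': "\<And>t. t \<in> {a..b} \<Longrightarrow> (c has_derivative c' t) (at t within {a..b})"
    and cont: "continuous_on {a..b} (\<lambda>t. c' t 1)"
    unfolding Ck_on.simps by metis
  have der: "(c has_vector_derivative c' t 1) (at t)" if t: "t \<in> {a<..<b}" for t
  proof -
    have d: "(c has_derivative c' t) (at t)"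
      using c'[of t] t at_within_Icc_at[of a t b] by auto
    then interpret bounded_linear "c' t" by (rule has_derivative_bounded_linear)
    have "c' t = (\<lambda>h. h *\<^sub>R c' t 1)" by (metis mult.right_neutral real_scaleR_def scaleR)
    then show ?thesis using d unfolding has_vector_derivative_def by simp
  qed
  have "{t\<in>{a..b}. \<not> c differentiable (at t)} \<subseteq> {a, b}"
  proof
    fix t assume "t \<in> {t\<in>{a..b}. \<not> c differentiable (at t)}"
    then show "t \<in> {a, b}" using differentiableI_vector[OF der[of t]] by fastforce
  qed
  moreover have "(\<lambda>t. f t \<bullet> vector_derivative c (at t)) integrable_on {a..b}"
    if f: "continuous_on UNIV f" for f
  proof (rule integrable_spike_finite)
    show "(\<lambda>t. f t \<bullet> c' t 1) integrable_on {a..b}"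
      using f cont by (intro integrable_continuous_interval continuous_intros) (auto intro: continuous_on_subset)
    show "finite {a, b}" by simp
    show "f t \<bullet> vector_derivative c (at t) = f t \<bullet> c' t 1" if "t \<in> {a..b} - {a, b}" for t
      using der[of t] that by (simp add: vector_derivative_at)
  qed
  ultimately show ?thesis unfolding integrable_velocity_def by (auto intro: finite_subset)
qed

lemma closed_curve_derivative_shift:
  assumes "closed_curve c"
  shows "(c has_vector_derivative v) (at (t + 1)) \<longleftrightarrow> (c has_vector_derivative v) (at t)"
proof -
  have translate: "(c has_vector_derivative v) (at t)"
    if "(c has_vector_derivative v) (at (t + d))" "\<And>t. c (t + d) = c t" for t d
  proof -
    have "((\<lambda>t. t + d) has_vector_derivative 1) (at t)" by (auto intro!: derivative_eq_intros)
    then have "(c \<circ> (\<lambda>t. t + d) has_vector_derivative 1 *\<^sub>R v) (at t)"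
      by (rule vector_diff_chain_at) (rule that(1))
    then show ?thesis by (simp add: comp_def that(2))
  qed
  have period: "c (t + 1) = c t" for t using assms by (simp add: closed_curve_def)
  have "c (t - 1) = c t" for t using period[of "t - 1"] by simp
  then show ?thesis using translate[of t 1] translate[of "t + 1" "- 1"] period by auto
qed

lemma closed_curve_vector_derivative_shift:
  assumes "closed_curve c"
  shows "vector_derivative c (at (t + 1)) = vector_derivative c (at t)"
  unfolding vector_derivative_def closed_curve_derivative_shift[OF assms] ..

text \<open>Two periods are covered, so that the interval of length 1 starting at any time of the first
  period is available.\<close>

lemma integrable_velocity_closed_curve:
  assumes c: "piecewise_smooth_closed_curve c"
  shows "integrable_velocity c 0 2"
proof -
  obtain S where S: "finite S"
    "\<And>a b. 0 \<le> a \<Longrightarrow> a < b \<Longrightarrow> b \<le> 1 \<Longrightarrow> {a<..<b} \<inter> S = {} \<Longrightarrow> smooth_on {a..b} c"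
    using c unfolding piecewise_smooth_closed_curve_def by auto
  have closed: "closed_curve c" using c unfolding piecewise_smooth_closed_curve_def by auto
  have first_period: "integrable_velocity c 0 1"
  proof (rule interval_subdivision_induct[OF S(1), where lo=0 and hi=1])
    show "integrable_velocity c a b" if "0 \<le> a" "a \<le> b" "b \<le> 1" "{a<..<b} \<inter> S = {}" for a b
    proof (cases "a = b")
      case True
      then show ?thesis by (simp add: integrable_velocity_def integrable_on_refl[of _ b, simplified])
    next
      case False
      then show ?thesis using that S(2)[of a b] integrable_velocity_smooth[of a b c] by simp
    qed
  qed (use integrable_velocity_join in auto)
  moreover have "integrable_velocity c 1 2"
  proof -
    have diff: "c differentiable (at (t + 1)) \<longleftrightarrow> c differentiable (at t)" for t
      by (metis closed closed_curve_derivative_shift differentiableI_vector vector_derivative_works)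
    have "{t\<in>{1..2}. \<not> c differentiable (at t)} \<subseteq> (\<lambda>t. t + 1) ` {t\<in>{0..1}. \<not> c differentiable (at t)}"
    proof
      fix t assume t: "t \<in> {t\<in>{1..2}. \<not> c differentiable (at t)}"
      then have "t - 1 \<in> {t\<in>{0..1}. \<not> c differentiable (at t)}" using diff[of "t - 1"] by simp
      then show "t \<in> (\<lambda>t. t + 1) ` {t\<in>{0..1}. \<not> c differentiable (at t)}"
        by (intro image_eqI[of _ _ "t - 1"]) auto
    qed
    moreover have "(\<lambda>t. f t \<bullet> vector_derivative c (at t)) integrable_on {1..2}"
      if f: "continuous_on UNIV f" for f
    proof -
      have "continuous_on UNIV (\<lambda>t. f (t + 1))"
        by (intro continuous_on_compose2[OF f] continuous_intros) auto
      then have "(\<lambda>t. f (t + 1) \<bullet> vector_derivative c (at (t + 1))) integrable_on {0..1}"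
        using first_period unfolding integrable_velocity_def closed_curve_vector_derivative_shift[OF closed] by blast
      moreover have "(\<lambda>t. f t \<bullet> vector_derivative c (at t)) \<circ> (+) 1 =
          (\<lambda>t. f (t + 1) \<bullet> vector_derivative c (at (t + 1)))"
        by (simp add: fun_eq_iff add.commute)
      ultimately show ?thesis
        using integrable_on_shift_Icc_real[of "\<lambda>t. f t \<bullet> vector_derivative c (at t)" 1 0 1] by simp
    qed
    ultimately show ?thesis using first_period unfolding integrable_velocity_def by (meson finite_imageI finite_subset)
  qed
  ultimately show ?thesis by (rule integrable_velocity_join) auto
qed

section \<open>Velocities of billiard trajectories\<close>

context smooth_strictly_convex_body
begin

text \<open>All three kinds of motion (flight, momentum change at a bounce point, and gliding on \<open>frontier K \<times> frontier T\<close>)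
  have a velocity of the form \<open>(- \<alpha> n, \<beta> r)\<close>, where \<open>n\<close> and \<open>r\<close> are the gradients of the two gauges
  and a coefficient can be nonzero only if the corresponding component lies on the boundary. The
  relations below follow from \<open>p \<bullet> n = 1 = g n\<close> and \<open>r \<in> T\<close>, \<open>r \<bullet> x = 1\<close>; they do not mention the
  coefficients any more.\<close>

lemma trajectory_velocity:
  assumes tr: "closed_KT_billiard_trajectory K T \<gamma>"
    and der: "(\<gamma> has_vector_derivative (v, w)) (at t)" and \<gamma>: "\<gamma> t = (x, p)"
  shows gauge_velocity: "g v = - (p \<bullet> v)"
    and momentum_velocity_le: "w \<bullet> z \<le> g z * (x \<bullet> w)"
    and momentum_frontier: "w \<noteq> 0 \<Longrightarrow> x \<in> frontier K"
    and velocity_nonzero: "v \<noteq> 0 \<or> w \<noteq> 0"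
proof -
  have fr: "(x, p) \<in> frontier (K \<times> T)"
    using tr \<gamma> unfolding closed_KT_billiard_trajectory_def by metis
  then have mem: "x \<in> K" "p \<in> T"
    using frontier_subset_closed[OF closed_K]
      frontier_subset_closed[OF symmetric_body.closed_K[OF symmetric_body_polar]]
    by (auto simp: frontier_product)
  have "\<exists>\<alpha> \<beta> n r. v = - \<alpha> *\<^sub>R n \<and> w = \<beta> *\<^sub>R r \<and> \<alpha> \<ge> 0 \<and> \<beta> \<ge> 0 \<and> (\<alpha> \<noteq> 0 \<or> \<beta> \<noteq> 0)
      \<and> (\<alpha> \<noteq> 0 \<longrightarrow> p \<in> frontier T \<and> n = grad (gauge_fun T) p)
      \<and> (\<beta> \<noteq> 0 \<longrightarrow> x \<in> frontier K \<and> r = grad g x)"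
  proof (cases "(x, p) \<in> frontier K \<times> frontier T")
    case True
    then obtain u where u: "u \<in> billiard_cone K T (x, p)" "(\<gamma> has_vector_derivative u) (at_left t)"
      using tr \<gamma> unfolding closed_KT_billiard_trajectory_def by metis
    have "(\<gamma> has_vector_derivative (v, w)) (at_left t)"
      using der by (rule has_vector_derivative_at_within)
    then have "u = (v, w)"
      using u(2) by (intro vector_derivative_unique_within[of t "{..<t}"]) auto
    then show ?thesis using u(1) True unfolding billiard_cone_def by fastforce
  next
    case False
    then obtain d where d: "d > 0" "(\<gamma> has_vector_derivative d *\<^sub>R billiard_field K T (x, p)) (at t)"
      using tr \<gamma> unfolding closed_KT_billiard_trajectory_def by metis
    then have vw: "(v, w) = d *\<^sub>R billiard_field K T (x, p)"
      using der by (intro vector_derivative_unique_at)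
    show ?thesis
    proof (cases "x \<in> interior K \<and> p \<in> frontier T")
      case True
      then show ?thesis using vw d
        by (intro exI[of _ d] exI[of _ 0] exI[of _ "grad (gauge_fun T) p"]) (auto simp: billiard_field_def)
    next
      case no: False
      then have "x \<in> frontier K" using fr mem(1) closed_K by (auto simp: frontier_product) (simp add: frontier_def)
      then show ?thesis using vw d no
        by (intro exI[of _ 0] exI[of _ d] exI[of _ "grad (gauge_fun T) p"] exI[of _ "grad g x"])
          (auto simp: billiard_field_def)
    qed
  qed
  then obtain \<alpha> \<beta> n r where v: "v = - \<alpha> *\<^sub>R n" and w: "w = \<beta> *\<^sub>R r"
    and nonneg: "\<alpha> \<ge> 0" "\<beta> \<ge> 0" and nz: "\<alpha> \<noteq> 0 \<or> \<beta> \<noteq> 0"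
    and \<alpha>: "\<alpha> \<noteq> 0 \<Longrightarrow> p \<in> frontier T \<and> n = grad (gauge_fun T) p"
    and \<beta>: "\<beta> \<noteq> 0 \<Longrightarrow> x \<in> frontier K \<and> r = grad g x"
    by blast
  show gv: "g v = - (p \<bullet> v)"
  proof (cases "\<alpha> = 0")
    case False
    then have n: "n \<in> K" "p \<bullet> n = 1" using \<alpha> grad_gauge_polar_normal by auto
    then have "g n = 1" using mem_iff_gauge inner_le_gauge[OF mem(2), of n] by fastforce
    then show ?thesis using n nonneg by (simp add: v gauge_uminus gauge_scale)
  qed (simp add: v)
  show "w \<bullet> z \<le> g z * (x \<bullet> w)"
  proof (cases "\<beta> = 0")
    case False
    then have r: "r \<in> T" "r \<bullet> x = 1" using \<beta> grad_gauge_normal by auto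
    then show ?thesis
      using mult_left_mono[OF inner_le_gauge[OF r(1), of z] nonneg(2)]
      by (simp add: w inner_commute[of x] mult.commute)
  qed (simp add: w)
  show "w \<noteq> 0 \<Longrightarrow> x \<in> frontier K" using \<beta> w by auto
  have "v \<noteq> 0" if "\<alpha> \<noteq> 0"
  proof -
    have "p \<bullet> n = 1" using that \<alpha> grad_gauge_polar_normal by auto
    then show ?thesis using that v by auto
  qed
  moreover have "w \<noteq> 0" if "\<beta> \<noteq> 0"
  proof -
    have "r \<bullet> x = 1" using that \<beta> grad_gauge_normal by auto
    then show ?thesis using that w by auto
  qed
  ultimately show "v \<noteq> 0 \<or> w \<noteq> 0" using nz by blast
qed

end

lemma has_integral_le_off_finite:
  fixes f :: "'a::euclidean_space \<Rightarrow> real"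
  assumes "finite E" "(f has_integral i) S" "(h has_integral j) S" "\<And>t. t \<in> S - E \<Longrightarrow> f t \<le> h t"
  shows "i \<le> j"
proof (rule has_integral_le)
  show "((\<lambda>t. if t \<in> E then 0 else f t) has_integral i) S"
    by (rule has_integral_spike_finite[OF assms(1) _ assms(2)]) auto
  show "((\<lambda>t. if t \<in> E then 0 else h t) has_integral j) S"
    by (rule has_integral_spike_finite[OF assms(1) _ assms(3)]) auto
qed (use assms(4) in auto)

lemma constant_imp_zero_derivative:
  fixes c :: "real \<Rightarrow> 'b::real_normed_vector"
  assumes "(c has_vector_derivative v) (at t)" "t \<in> {a<..<b}" "\<And>t. t \<in> {a<..<b} \<Longrightarrow> c t = k"
  shows "v = 0"
proof (rule vector_derivative_unique_at[OF assms(1)])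
  have "((\<lambda>_. k) has_vector_derivative 0) (at t)" by (rule has_vector_derivative_const)
  then show "(c has_vector_derivative 0) (at t)"
    by (rule has_vector_derivative_transform_within_open[where S="{a<..<b}"]) (use assms(2,3) in auto)
qed

section \<open>The lower bound for the length\<close>

locale billiard = smooth_strictly_convex_body +
  fixes \<gamma> :: "real \<Rightarrow> 'a \<times> 'a"
  assumes trajectory: "closed_KT_billiard_trajectory K T \<gamma>"
begin

abbreviation "q \<equiv> fst \<circ> \<gamma>"
abbreviation "p \<equiv> snd \<circ> \<gamma>"
abbreviation "dq t \<equiv> vector_derivative q (at t)"
abbreviation "dp t \<equiv> vector_derivative p (at t)"

definition "len a b = integral {a..b} (\<lambda>t. g (dq t))"

definition "breaks = {t\<in>{0..2}. \<not> \<gamma> differentiable (at t)}"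

lemma piecewise_smooth: "piecewise_smooth_closed_curve \<gamma>"
  using trajectory by (simp add: closed_KT_billiard_trajectory_def)

lemma finite_breaks: "finite breaks"
  using integrable_velocity_closed_curve[OF piecewise_smooth] by (simp add: integrable_velocity_def breaks_def)

lemma continuous_\<gamma>: "continuous_on A \<gamma>"
  using piecewise_smooth continuous_on_subset[of UNIV \<gamma> A] by (auto simp: piecewise_smooth_closed_curve_def)

lemma continuous_q: "continuous_on A q" and continuous_p: "continuous_on A p"
  unfolding comp_def by (intro continuous_intros continuous_\<gamma>)+

lemma periodic_q: "q (t + 1) = q t" and periodic_p: "p (t + 1) = p t"
  using piecewise_smooth by (simp_all add: piecewise_smooth_closed_curve_def closed_curve_def)

lemma derivative:
  assumes "t \<in> {0..2} - breaks"
  shows derivative_q: "(q has_vector_derivative dq t) (at t)"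
    and derivative_p: "(p has_vector_derivative dp t) (at t)"
    and derivative_\<gamma>: "(\<gamma> has_vector_derivative (dq t, dp t)) (at t)"
proof -
  define w where "w = vector_derivative \<gamma> (at t)"
  have w: "(\<gamma> has_vector_derivative w) (at t)"
    using assms by (simp add: breaks_def w_def vector_derivative_works)
  have "(q has_vector_derivative fst w) (at t)"
    unfolding comp_def by (rule bounded_linear.has_vector_derivative[OF bounded_linear_fst w])
  moreover have "(p has_vector_derivative snd w) (at t)"
    unfolding comp_def by (rule bounded_linear.has_vector_derivative[OF bounded_linear_snd w])
  ultimately show "(q has_vector_derivative dq t) (at t)" "(p has_vector_derivative dp t) (at t)"
    "(\<gamma> has_vector_derivative (dq t, dp t)) (at t)"
    using w by (simp_all add: vector_derivative_at)
qed

lemma mem_body: "q t \<in> K" "p t \<in> T"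
proof -
  have "(q t, p t) \<in> frontier (K \<times> T)"
    using trajectory by (simp add: closed_KT_billiard_trajectory_def)
  then show "q t \<in> K" "p t \<in> T"
    using frontier_subset_closed[OF closed_K]
      frontier_subset_closed[OF symmetric_body.closed_K[OF symmetric_body_polar]]
    unfolding frontier_product by auto
qed

lemma velocity:
  assumes "t \<in> {0..2} - breaks"
  shows g_dq: "g (dq t) = - (p t \<bullet> dq t)"
    and dp_le: "dp t \<bullet> z \<le> g z * (q t \<bullet> dp t)"
    and dp_frontier: "dp t \<noteq> 0 \<Longrightarrow> q t \<in> frontier K"
    and moving: "dq t \<noteq> 0 \<or> dp t \<noteq> 0"
  using trajectory_velocity[OF trajectory derivative_\<gamma>[OF assms], of "q t" "p t"] by auto

lemma q_dp_nonneg: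
  assumes "t \<in> {0..2} - breaks"
  shows "q t \<bullet> dp t \<ge> 0"
  using dp_le[OF assms, of "q t"] mem_body(1)[of t] dp_le[OF assms, of "- q t"]
    gauge_nonneg[of "q t"]
  by (smt (verit) gauge_uminus inner_commute inner_minus_left mult_nonneg_nonpos)

lemma ftc_q: 
  assumes "0 \<le> a" "a \<le> b" "b \<le> 2"
  shows "((\<lambda>t. z \<bullet> dq t) has_integral (z \<bullet> (q b - q a))) {a..b}"
  unfolding inner_diff_right
proof (rule fundamental_theorem_of_calculus_interior_strong[OF finite_breaks assms(2)])
  show "((\<lambda>t. z \<bullet> q t) has_vector_derivative z \<bullet> dq t) (at t)" if "t \<in> {a<..<b} - breaks" for t
    using that assms by (intro bounded_linear.has_vector_derivative[OF bounded_linear_inner_right] derivative_q) auto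
qed (intro continuous_intros continuous_q)

lemma ftc_p: 
  assumes "0 \<le> a" "a \<le> b" "b \<le> 2"
  shows "((\<lambda>t. z \<bullet> dp t) has_integral (z \<bullet> (p b - p a))) {a..b}"
  unfolding inner_diff_right
proof (rule fundamental_theorem_of_calculus_interior_strong[OF finite_breaks assms(2)])
  show "((\<lambda>t. z \<bullet> p t) has_vector_derivative z \<bullet> dp t) (at t)" if "t \<in> {a<..<b} - breaks" for t
    using that assms by (intro bounded_linear.has_vector_derivative[OF bounded_linear_inner_right] derivative_p) auto
qed (intro continuous_intros continuous_p)

lemma ftc_qp: 
  assumes "0 \<le> a" "a \<le> b" "b \<le> 2"
  shows "((\<lambda>t. q t \<bullet> dp t + dq t \<bullet> p t) has_integral (q b \<bullet> p b - q a \<bullet> p a)) {a..b}"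
proof (rule fundamental_theorem_of_calculus_interior_strong[OF finite_breaks assms(2)])
  show "((\<lambda>t. q t \<bullet> p t) has_vector_derivative q t \<bullet> dp t + dq t \<bullet> p t) (at t)" if "t \<in> {a<..<b} - breaks" for t
    using that assms
    by (intro bounded_bilinear.has_vector_derivative[OF bounded_bilinear_inner] derivative_p derivative_q) auto
qed (intro continuous_intros continuous_p continuous_q)

text \<open>The speed is the product of the velocity with the continuous function \<open>(- p, 0)\<close>.\<close>

lemma integrable_speed:
  assumes "0 \<le> a" "b \<le> 2"
  shows "(\<lambda>t. g (dq t)) integrable_on {a..b}"
proof -
  have "(\<lambda>t. (- p t, 0) \<bullet> vector_derivative \<gamma> (at t)) integrable_on {0..2}"
  proof -
    have "continuous_on UNIV (\<lambda>t. (- p t, 0 :: 'a))" by (intro continuous_intros continuous_p)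
    then show ?thesis
      using integrable_velocity_closed_curve[OF piecewise_smooth] unfolding integrable_velocity_def by blast
  qed
  then have "(\<lambda>t. g (dq t)) integrable_on {0..2}"
  proof (rule integrable_spike_finite[OF finite_breaks, rotated])
    fix t assume t: "t \<in> {0..2} - breaks"
    show "g (dq t) = (- p t, 0) \<bullet> vector_derivative \<gamma> (at t)"
      using g_dq[OF t] vector_derivative_at[OF derivative_\<gamma>[OF t]] by simp
  qed
  then show ?thesis by (rule integrable_subinterval_real) (use assms in auto)
qed

lemma len_has_integral:
  assumes "0 \<le> a" "b \<le> 2"
  shows "((\<lambda>t. g (dq t)) has_integral len a b) {a..b}"
  unfolding len_def using integrable_speed[OF assms] by (rule integrable_integral)

lemma len_nonneg: "len a b \<ge> 0"
  unfolding len_def using gauge_nonneg by (cases "(\<lambda>t. g (dq t)) integrable_on {a..b}")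
    (auto intro: integral_nonneg simp: not_integrable_integral)

lemma len_combine: "0 \<le> a \<Longrightarrow> a \<le> b \<Longrightarrow> b \<le> c \<Longrightarrow> c \<le> 2 \<Longrightarrow> len a b + len b c = len a c"
  unfolding len_def by (rule Henstock_Kurzweil_Integration.integral_combine) (auto intro: integrable_speed)

text \<open>By duality it is enough to integrate \<open>r \<bullet> q'\<close> for each \<open>r \<in> T\<close>.\<close>

lemma gauge_chord_le_len:
  assumes "0 \<le> a" "a \<le> b" "b \<le> 2"
  shows "g (q b - q a) \<le> len a b"
  unfolding gauge_le_iff
proof
  fix r assume "r \<in> T"
  then show "r \<bullet> (q b - q a) \<le> len a b"
    using assms by (intro has_integral_le[OF ftc_q len_has_integral]) (auto intro: inner_le_gauge)
qed

lemma len_period: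
  assumes "0 \<le> s" "s \<le> 1"
  shows "len s (s + 1) = len 0 1"
proof -
  have "closed_curve q" using periodic_q by (simp add: closed_curve_def)
  then have "dq (1 + t) = dq t" for t
    using closed_curve_vector_derivative_shift[of q t] by (simp add: add.commute)
  then have shift: "(\<lambda>t. g (dq t)) \<circ> (+) 1 = (\<lambda>t. g (dq t))" by auto
  have "((\<lambda>t. g (dq t)) has_integral len 0 s) {0 + 1..s + 1}"
    using len_has_integral[of 0 s] assms
    by (subst has_integral_shift_Icc_real[symmetric]) (simp add: shift)
  then have "len 1 (s + 1) = len 0 s" unfolding len_def by (simp add: integral_unique)
  then show ?thesis
    using len_combine[of s 1 "s + 1"] len_combine[of 0 s 1] assms by simp
qed

text \<open>The integral of \<open>q \<bullet> p'\<close> over an interval, in the closed form that integration by parts gives.\<close>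

definition "work a b = q b \<bullet> p b - q a \<bullet> p a + len a b"

lemma work_has_integral:
  assumes "0 \<le> a" "a \<le> b" "b \<le> 2"
  shows "((\<lambda>t. q t \<bullet> dp t) has_integral work a b) {a..b}"
proof -
  have "((\<lambda>t. (q t \<bullet> dp t + dq t \<bullet> p t) + g (dq t)) has_integral work a b) {a..b}"
    unfolding work_def using assms by (intro has_integral_add ftc_qp len_has_integral) auto
  then show ?thesis
  proof (rule has_integral_spike_finite[OF finite_breaks, rotated])
    fix t assume "t \<in> {a..b} - breaks"
    then show "q t \<bullet> dp t = (q t \<bullet> dp t + dq t \<bullet> p t) + g (dq t)"
      using g_dq[of t] assms by (simp add: inner_commute)
  qed
qed

lemma work_period: "0 \<le> s \<Longrightarrow> s \<le> 1 \<Longrightarrow> work s (s + 1) = len 0 1"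
  unfolding work_def by (simp only: periodic_q periodic_p len_period)

lemma work_nonneg:
  assumes "0 \<le> a" "a \<le> b" "b \<le> 2"
  shows "work a b \<ge> 0"
  using assms q_dp_nonneg
  by (intro has_integral_le_off_finite[OF finite_breaks has_integral_0 work_has_integral]) auto

lemma momentum_change_le_work:
  assumes "0 \<le> a" "a \<le> b" "b \<le> 2"
  shows "z \<bullet> (p b - p a) \<le> g z * work a b"
  using assms dp_le
  by (intro has_integral_le_off_finite[OF finite_breaks ftc_p has_integral_mult_right[OF work_has_integral]])
    (auto simp: inner_commute)

lemma generic_time:
  assumes "0 \<le> a" "a < b" "b \<le> 2"
  obtains t where "t \<in> {a<..<b}" "t \<in> {0..2} - breaks"
proof -
  have "infinite ({a<..<b} - breaks)"
    using assms finite_breaks by (simp add: Diff_infinite_finite infinite_Ioo)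
  then obtain t where "t \<in> {a<..<b} - breaks" by (metis all_not_in_conv finite.emptyI)
  then show ?thesis using that[of t] assms by auto
qed

text \<open>A trajectory of length 0 would be constant: its position does not move, and \<open>q \<bullet> p'\<close>, which
  controls the change of momentum, has integral 0. But the velocity of a trajectory never vanishes.\<close>

lemma len_pos: "len 0 1 > 0"
proof (rule ccontr)
  assume "\<not> len 0 1 > 0"
  then have zero: "len 0 1 = 0" using len_nonneg[of 0 1] by simp
  have q: "q t = q 0" if "t \<in> {0<..<1}" for t
  proof -
    have "len 0 t = 0" using len_combine[of 0 t 1] len_nonneg[of 0 t] len_nonneg[of t 1] zero that by auto
    then have "g (q t - q 0) = 0"
      using gauge_chord_le_len[of 0 t] gauge_nonneg[of "q t - q 0"] that by auto
    then show ?thesis by (simp add: gauge_eq_0_iff)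
  qed
  have p: "p t = p 0" if t: "t \<in> {0<..<1}" for t
  proof -
    have "work 0 t + work t 1 = work 0 1"
      unfolding work_def using len_combine[of 0 t 1] t by simp
    also have "\<dots> = 0" using work_period[of 0] zero by simp
    finally have "work 0 t = 0" using work_nonneg[of 0 t] work_nonneg[of t 1] t by simp
    then have "(p t - p 0) \<bullet> (p t - p 0) \<le> 0"
      using momentum_change_le_work[of 0 t "p t - p 0"] t by simp
    then have "p t - p 0 = 0" by (metis inner_gt_zero_iff not_less)
    then show ?thesis by simp
  qed
  obtain t where t: "t \<in> {0<..<1}" "t \<in> {0..2} - breaks" using generic_time[of 0 1] by auto
  have "dq t = 0" using constant_imp_zero_derivative[OF derivative_q[OF t(2)] t(1) q] .
  moreover have "dp t = 0" using constant_imp_zero_derivative[OF derivative_p[OF t(2)] t(1) p] .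
  ultimately show False using moving[OF t(2)] by simp
qed


text \<open>Without bounces the momentum would be constant, and \<open>q \<bullet> p'\<close> could not have a positive integral.\<close>

lemma exists_bounce:
  obtains s where "0 \<le> s" "s \<le> 1" "q s \<in> frontier K"
proof -
  have "\<exists>s\<in>{0..1} - breaks. q s \<bullet> dp s \<noteq> 0"
  proof (rule ccontr)
    assume "\<not> ?thesis"
    then have "work 0 1 \<le> 0"
      by (intro has_integral_le_off_finite[OF finite_breaks work_has_integral has_integral_0]) auto
    then show False using work_period[of 0] len_pos by simp
  qed
  then obtain s where s: "s \<in> {0..1} - breaks" "q s \<bullet> dp s \<noteq> 0" by blast
  then have "dp s \<noteq> 0" by auto
  then have "q s \<in> frontier K" using dp_frontier[of s] s by auto
  then show ?thesis using that s by auto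
qed

lemma halving:
  assumes "0 \<le> s" "s \<le> 1"
  obtains m where "s \<le> m" "m \<le> s + 1" "len s m = len 0 1 / 2" "len m (s + 1) = len 0 1 / 2"
proof -
  have "\<exists>m\<ge>s. m \<le> s + 1 \<and> len s m = len 0 1 / 2"
  proof (rule IVT')
    show "len s s \<le> len 0 1 / 2" using len_nonneg[of 0 1] by (simp add: len_def)
    show "len 0 1 / 2 \<le> len s (s + 1)" using len_period[OF assms] len_nonneg[of 0 1] by simp
    show "continuous_on {s..s + 1} (len s)"
      unfolding len_def using assms by (intro indefinite_integral_continuous_1 integrable_speed) auto
  qed auto
  then obtain m where m: "s \<le> m" "m \<le> s + 1" "len s m = len 0 1 / 2" by auto
  then show ?thesis using that[of m] len_combine[of s m "s + 1"] len_period assms by simp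
qed

text \<open>The two halving points cut the arc through \<open>q t\<close> off at its ends, and \<open>q t\<close> divides it into parts
  whose lengths bound the two distances and add up to half of the total length.\<close>

lemma distance_to_halving_points:
  assumes "0 \<le> s" "s \<le> 1" "s \<le> m" "m \<le> s + 1" "len s m = len 0 1 / 2" "len m (s + 1) = len 0 1 / 2"
    and t: "s \<le> t" "t \<le> s + 1"
  shows "g (q t - q s) + g (q t - q m) \<le> len 0 1 / 2"
proof (cases "t \<le> m")
  case True
  then show ?thesis
    using gauge_chord_le_len[of s t] gauge_chord_le_len[of t m] len_combine[of s t m] assms
    unfolding gauge_minus_commute[of "q t" "q m"] by linarith
next
  case False
  have "g (q t - q s) = g (q (s + 1) - q t)" by (simp only: periodic_q gauge_minus_commute)
  then show ?thesis
    using gauge_chord_le_len[of m t] gauge_chord_le_len[of t "s + 1"] len_combine[of m t "s + 1"] assms False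
    by linarith
qed

lemma distance_to_midpoint:
  assumes "g (x - a) + g (x - b) \<le> c"
  shows "g (x - midpoint a b) \<le> c / 2"
proof -
  have "x - midpoint a b = (1/2) *\<^sub>R ((x - a) + (x - b))"
    by (simp add: midpoint_def algebra_simps flip: scaleR_add_left)
  then have "g (x - midpoint a b) = (1/2) * g ((x - a) + (x - b))" by (simp only: gauge_scale)
  also have "\<dots> \<le> (1/2) * (g (x - a) + g (x - b))" by (intro mult_left_mono gauge_triangle) auto
  finally show ?thesis using assms by simp
qed

lemma translated_work_has_integral:
  assumes "0 \<le> s" "s \<le> 1"
  shows "((\<lambda>t. dp t \<bullet> (q t - z)) has_integral len 0 1) {s..s + 1}"
proof -
  have "((\<lambda>t. q t \<bullet> dp t - z \<bullet> dp t) has_integral work s (s + 1) - z \<bullet> (p (s + 1) - p s)) {s..s + 1}"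
    using assms by (intro has_integral_diff work_has_integral ftc_p) auto
  moreover have "p (s + 1) - p s = 0" by (simp only: periodic_p) simp
  ultimately show ?thesis
    using work_period[OF assms] by (simp add: inner_diff_right inner_commute[of "dp _"])
qed

text \<open>The curve lies in the ball of radius \<open>L/4\<close> around the midpoint \<open>z\<close> of two halving points. Comparing
  the integrals of \<open>p' \<bullet> (q - z) \<le> L/4 * (q \<bullet> p')\<close> over a period gives \<open>L \<le> L/4 * L\<close>.\<close>

lemma length_ge_4: "len 0 1 \<ge> 4"
proof -
  obtain m where m: "0 \<le> m" "m \<le> 1" "len 0 m = len 0 1 / 2" "len m 1 = len 0 1 / 2"
    using halving[of 0] by auto
  let ?z = "midpoint (q 0) (q m)"
  have "len 0 1 \<le> len 0 1 / 4 * work 0 1"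
  proof (rule has_integral_le_off_finite[OF finite_breaks])
    show "((\<lambda>t. dp t \<bullet> (q t - ?z)) has_integral len 0 1) {0..1}"
      using translated_work_has_integral[of 0] by simp
    show "((\<lambda>t. len 0 1 / 4 * (q t \<bullet> dp t)) has_integral len 0 1 / 4 * work 0 1) {0..1}"
      by (intro has_integral_mult_right work_has_integral) auto
    fix t assume t: "t \<in> {0..1} - breaks"
    have "g (q t - ?z) \<le> len 0 1 / 4"
      using distance_to_midpoint[OF distance_to_halving_points[of 0 m t]] m t by simp
    then have "g (q t - ?z) * (q t \<bullet> dp t) \<le> len 0 1 / 4 * (q t \<bullet> dp t)"
      using q_dp_nonneg[of t] t by (intro mult_right_mono) auto
    then show "dp t \<bullet> (q t - ?z) \<le> len 0 1 / 4 * (q t \<bullet> dp t)"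
      using dp_le[of t "q t - ?z"] t by simp
  qed
  then have "4 * len 0 1 \<le> len 0 1 * len 0 1" using work_period[of 0] by simp
  then show ?thesis using len_pos by simp
qed

end

section \<open>Trajectories of length 4\<close>

text \<open>The equality case of the triangle inequality \<open>g (2 x) \<le> g a + g b\<close>: the normal \<open>r\<close> at \<open>x\<close> must be
  maximal at the normalised \<open>a\<close>, which by strict convexity is then \<open>x\<close>.\<close>

lemma (in smooth_strictly_convex_body) triangle_equality:
  assumes x: "x \<in> frontier K" and u: "0 \<le> u" "a + b = 2 *\<^sub>R x" "g a \<le> 2 * u" "g b \<le> 2 * (1 - u)"
  shows "a = (2 * u) *\<^sub>R x"
proof (cases "u = 0")
  case True
  then show ?thesis using u(3) gauge_nonneg[of a] gauge_eq_0_iff[of a] by simp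
next
  case False
  define r where "r = grad g x"
  have r: "r \<in> T" "r \<bullet> x = 1" using grad_gauge_normal[OF x] by (simp_all add: r_def)
  have "r \<bullet> a + r \<bullet> b = 2" using u(2) r(2) by (simp flip: inner_add_right)
  moreover have "r \<bullet> a \<le> 2 * u" "r \<bullet> b \<le> 2 - 2 * u"
    using inner_le_gauge[OF r(1), of a] inner_le_gauge[OF r(1), of b] u(3,4) by auto
  ultimately have ra: "r \<bullet> a = 2 * u" by linarith
  have "(1 / (2 * u)) *\<^sub>R a = x"
  proof (rule maximizer_unique[OF r(1)])
    show "(1 / (2 * u)) *\<^sub>R a \<in> K" using u(1,3) False by (simp add: mem_iff_gauge gauge_scale)
    show "x \<in> K" using x frontier_subset_closed[OF closed_K] by blast
  qed (use ra r(2) False in auto)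
  then have "(2 * u) *\<^sub>R ((1 / (2 * u)) *\<^sub>R a) = (2 * u) *\<^sub>R x" by (simp only:)
  then show ?thesis using False by simp
qed

lemma closed_curve_int_shift:
  assumes "closed_curve c"
  shows "c (t + of_int k) = c t"
proof (induction k rule: int_induct[where k = 0])
  case (step1 i)
  have "c (t + of_int i + 1) = c (t + of_int i)" using assms unfolding closed_curve_def by blast
  then show ?case using step1 by (simp add: add_ac)
next
  case (step2 i)
  have "c (t + of_int (i - 1) + 1) = c (t + of_int (i - 1))" using assms unfolding closed_curve_def by blast
  then show ?case using step2 by simp
qed simp

context billiard
begin

text \<open>Normalised by \<open>q \<bullet> p'\<close>, a nonzero momentum velocity lies in \<open>T\<close> and supports \<open>K\<close> at \<open>q\<close>; strict
  convexity makes the point of support unique.\<close>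

lemma maximizer_of_momentum_velocity:
  assumes "t \<in> {0..2} - breaks" "dp t \<noteq> 0" "y \<in> K" "dp t \<bullet> y = q t \<bullet> dp t"
  shows "y = q t"
proof -
  define \<beta> where "\<beta> = q t \<bullet> dp t"
  have \<beta>: "\<beta> > 0"
  proof -
    have "0 < dp t \<bullet> dp t" using assms(2) by simp
    also have "\<dots> \<le> g (dp t) * \<beta>" unfolding \<beta>_def by (rule dp_le[OF assms(1)])
    finally show ?thesis using gauge_nonneg[of "dp t"] by (simp add: zero_less_mult_iff)
  qed
  have "(1 / \<beta>) *\<^sub>R dp t \<in> T"
  proof -
    have "dp t \<bullet> x \<le> \<beta>" if "x \<in> K" for x
    proof -
      have "dp t \<bullet> x \<le> g x * \<beta>" unfolding \<beta>_def by (rule dp_le[OF assms(1)])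
      also have "\<dots> \<le> 1 * \<beta>" using that \<beta> by (intro mult_right_mono) (auto simp: mem_iff_gauge)
      finally show ?thesis by simp
    qed
    then show ?thesis using \<beta> by (simp add: polar_body_def)
  qed
  then show ?thesis
    using maximizer_unique[of "(1 / \<beta>) *\<^sub>R dp t" y "q t"] assms(3,4) mem_body(1) \<beta>
    by (simp add: \<beta>_def inner_commute)
qed

text \<open>If \<open>L = 4\<close>, the curve lies in \<open>z + K\<close>, so \<open>z \<bullet> p'\<close> is nonnegative. Hence \<open>z \<bullet> p\<close> is monotone and
  periodic, that is, constant. At a time when the momentum moves, \<open>q - z\<close> therefore is as good a
  maximiser of \<open>p'\<close> on \<open>K\<close> as \<open>q\<close>, so \<open>z = 0\<close>.\<close>

lemma halving_points_antipodal:
  assumes len4: "len 0 1 = 4" and s: "0 \<le> s" "s \<le> 1"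
    and m: "s \<le> m" "m \<le> s + 1" "len s m = 2" "len m (s + 1) = 2"
  shows "q m = - q s"
proof -
  let ?z = "midpoint (q s) (q m)"
  have near: "q t - ?z \<in> K" if "s \<le> t" "t \<le> s + 1" for t
    using distance_to_midpoint[OF distance_to_halving_points[of s m t]] s m that len4
    by (simp add: mem_iff_gauge)
  have drift: "?z \<bullet> dp t \<ge> 0" if t: "t \<in> {s..s + 1} - breaks" for t
  proof -
    have t2: "t \<in> {0..2} - breaks" using t s by auto
    have "dp t \<bullet> (q t - ?z) \<le> g (q t - ?z) * (q t \<bullet> dp t)" by (rule dp_le[OF t2])
    also have "\<dots> \<le> 1 * (q t \<bullet> dp t)"
      using near[of t] q_dp_nonneg[OF t2] t by (intro mult_right_mono) (auto simp: mem_iff_gauge)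
    finally show ?thesis by (simp add: inner_diff_right inner_commute)
  qed
  have mono: "?z \<bullet> (p b - p a) \<ge> 0" if "s \<le> a" "a \<le> b" "b \<le> s + 1" for a b
    using that s drift by (intro has_integral_le_off_finite[OF finite_breaks has_integral_0 ftc_p]) auto
  have const: "?z \<bullet> p t = ?z \<bullet> p s" if "t \<in> {s<..<s + 1}" for t
    using mono[of s t] mono[of t "s + 1"] that by (simp only: periodic_p) (auto simp: inner_diff_right)
  have zdp: "?z \<bullet> dp t = 0" if t: "t \<in> {s<..<s + 1} - breaks" for t
  proof (rule constant_imp_zero_derivative[OF _ _ const])
    show "((\<lambda>t. ?z \<bullet> p t) has_vector_derivative ?z \<bullet> dp t) (at t)"
      using t s by (intro bounded_linear.has_vector_derivative[OF bounded_linear_inner_right] derivative_p) auto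
  qed (use t in auto)
  have "\<exists>t\<in>{s<..<s + 1} - breaks. dp t \<noteq> 0"
  proof (rule ccontr)
    assume "\<not> ?thesis"
    then have "work s (s + 1) \<le> 0"
      using s by (intro has_integral_le_off_finite[of "breaks \<union> {s, s + 1}", OF _ work_has_integral has_integral_0])
        (auto simp: finite_breaks)
    then show False using work_period[OF s] len4 by simp
  qed
  then obtain t where t: "t \<in> {s<..<s + 1} - breaks" "dp t \<noteq> 0" by blast
  have "q t - ?z = q t"
  proof (rule maximizer_of_momentum_velocity)
    show "dp t \<bullet> (q t - ?z) = q t \<bullet> dp t"
      using zdp[OF t(1)] by (simp add: inner_diff_right inner_commute)
  qed (use t s near in auto)
  then have "midpoint (q s) (q m) = 0" by simp
  then show ?thesis by (simp add: midpoint_def eq_neg_iff_add_eq_0 add.commute)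
qed

text \<open>Start at a bounce point \<open>x\<close>. Both arcs to the halving point \<open>- x\<close> have length 2, the distance of
  their endpoints, so each point of the curve lies on the segment between \<open>x\<close> and \<open>- x\<close>, at the
  parameter given by half the arc length from \<open>x\<close>.\<close>

lemma shortest_is_two_bouncing:
  assumes len4: "len 0 1 = 4"
  shows "two_bouncing_orbit T K q"
proof -
  obtain s where s: "0 \<le> s" "s \<le> 1" "q s \<in> frontier K" by (rule exists_bounce)
  obtain m where m: "s \<le> m" "m \<le> s + 1" "len s m = 2" "len m (s + 1) = 2"
    using halving[OF s(1,2)] len4 by auto
  define x where "x = q s"
  have x: "x \<in> frontier K" using s by (simp add: x_def)
  have qm: "q m = - x" unfolding x_def by (rule halving_points_antipodal[OF len4 s(1,2) m])
  have qs1: "q (s + 1) = x" unfolding x_def by (rule periodic_q)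
  define u where "u t = (if t \<le> m then len s t / 2 else len t (s + 1) / 2)" for t
  have position: "q t = linepath x (- x) (u t) \<and> 0 \<le> u t" if t: "s \<le> t" "t \<le> s + 1" for t
  proof -
    have "g (x - q t) \<le> 2 * u t \<and> g (x + q t) \<le> 2 * (1 - u t)"
    proof (cases "t \<le> m")
      case True
      then show ?thesis
        using gauge_chord_le_len[of s t] gauge_chord_le_len[of t m] len_combine[of s t m] s m t
          gauge_minus_commute[of x "q t"] gauge_uminus[of "x + q t"] 
        by (simp add: u_def qm algebra_simps flip: x_def del: comp_apply)
    next
      case False
      have "g (x - q t) \<le> len t (s + 1)" "g (q t - - x) \<le> len m t"
        using gauge_chord_le_len[of t "s + 1", unfolded qs1] gauge_chord_le_len[of m t, unfolded qm] s m t False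
        by auto
      then show ?thesis
        using len_combine[of m t "s + 1"] s m t False by (simp add: u_def add.commute[of x] del: comp_apply)
    qed
    moreover have "0 \<le> u t" using len_nonneg by (simp add: u_def)
    moreover have "(x - q t) + (x + q t) = 2 *\<^sub>R x" by (simp add: scaleR_2)
    ultimately have "x - q t = (2 * u t) *\<^sub>R x" by (intro triangle_equality[OF x]) auto
    then have "q t = x - (2 * u t) *\<^sub>R x" by (metis add_diff_cancel diff_add_cancel add.commute)
    also have "\<dots> = linepath x (- x) (u t)"
      by (simp add: linepath_def algebra_simps flip: scaleR_left_distrib)
    finally show ?thesis using \<open>0 \<le> u t\<close> by blast
  qed
  have endpoints: "u s = 0" "u m = 1" "u (s + 1) = 0" "s < m" "m < s + 1"
  proof -
    have [simp]: "len t t = 0" for t by (simp add: len_def)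
    show "s < m" "m < s + 1" using m by (auto simp: less_le)
    then show "u s = 0" "u m = 1" "u (s + 1) = 0" using m by (simp_all add: u_def)
  qed
  have "mono_on {s..m} u"
  proof (rule mono_onI)
    fix a b assume "a \<in> {s..m}" "b \<in> {s..m}" "a \<le> b"
    then show "u a \<le> u b"
      using len_combine[of s a b] len_nonneg[of a b] s m by (simp add: u_def)
  qed
  moreover have "antimono_on {m..s + 1} u"
  proof (rule monotone_onI)
    have um: "u t = len t (s + 1) / 2" if "m \<le> t" for t using that m by (auto simp: u_def)
    fix a b assume "a \<in> {m..s + 1}" "b \<in> {m..s + 1}" "a \<le> b"
    then show "u b \<le> u a"
      using len_combine[of a b "s + 1"] len_nonneg[of a b] s m by (simp add: um)
  qed
  moreover have "range q \<inter> frontier K = {x, - x}"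
  proof
    have "- x \<in> frontier K" using x by (simp add: frontier_iff_gauge gauge_uminus)
    then show "{x, - x} \<subseteq> range q \<inter> frontier K"
      using x qm x_def by (metis IntI empty_subsetI insert_subset rangeI)
    show "range q \<inter> frontier K \<subseteq> {x, - x}"
    proof
      fix y assume "y \<in> range q \<inter> frontier K"
      then obtain t0 where y: "y = q t0" "y \<in> frontier K" by blast
      define t where "t = t0 + of_int (- \<lfloor>t0 - s\<rfloor>)"
      have "closed_curve q" using periodic_q by (simp add: closed_curve_def)
      then have "y = q t" unfolding y(1) t_def by (rule closed_curve_int_shift[symmetric])
      moreover have "s \<le> t" "t \<le> s + 1" unfolding t_def by linarith+
      ultimately have yu: "y = linepath x (- x) (u t)" using position by blast
      then have y': "y = (1 - 2 * u t) *\<^sub>R x"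
        by (simp add: linepath_def algebra_simps flip: scaleR_left_distrib)
      have "g y = \<bar>1 - 2 * u t\<bar>"
        unfolding y' gauge_scale_abs using x by (simp add: frontier_iff_gauge)
      then have "u t = 0 \<or> u t = 1" using y(2) frontier_iff_gauge by auto
      then show "y \<in> {x, - x}" unfolding yu by (auto simp: linepath_def)
    qed
  qed
  moreover have "x \<noteq> - x"
  proof
    assume "x = - x"
    then have "2 *\<^sub>R x = 0" by (metis scaleR_2 add.right_inverse)
    then have "x = 0" by simp
    then show False using x by (simp add: frontier_iff_gauge)
  qed
  moreover have "billiard_trajectory T K q"
    using trajectory unfolding billiard_trajectory_def by blast
  ultimately show ?thesis
    unfolding two_bouncing_orbit_def
    using position endpoints by (intro conjI exI[of _ x] exI[of _ "- x"] exI[of _ s] exI[of _ m] exI[of _ u]) auto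
qed

lemma gauge_length_eq_len: "gauge_length K q = len 0 1"
  unfolding gauge_length_def len_def ..

end

section \<open>The minimum\<close>

theorem theorem1p8:
  fixes K :: "(real ^ 'n) set"
  assumes "convex_body K"
    and "centrally_symmetric K"
    and "strictly_convex K"
    and "smooth_boundary K"
    and "smooth_boundary (polar_body K)"
  shows "(\<exists>q. is_arg_min (gauge_length K) (billiard_trajectory (polar_body K) K) q) \<and>
    (\<forall>q. is_arg_min (gauge_length K) (billiard_trajectory (polar_body K) K) q \<longrightarrow>
       two_bouncing_orbit (polar_body K) K q) \<and>
    (\<forall>q. is_arg_min (gauge_length K) (billiard_trajectory (polar_body K) K) q \<longrightarrow>
       gauge_length K q = 4)"
proof -
  interpret smooth_strictly_convex_body K by unfold_locales (use assms in auto)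
  have lower: "gauge_length K q \<ge> 4 \<and> (gauge_length K q = 4 \<longrightarrow> two_bouncing_orbit T K q)"
    if tr: "billiard_trajectory T K q" for q
  proof -
    obtain \<gamma> where \<gamma>: "closed_KT_billiard_trajectory K T \<gamma>" "q = fst \<circ> \<gamma>"
      using tr unfolding billiard_trajectory_def by blast
    interpret billiard K \<gamma> by unfold_locales (rule \<gamma>(1))
    show ?thesis
      using length_ge_4 shortest_is_two_bouncing unfolding \<gamma>(2) gauge_length_eq_len by blast
  qed
  have "frontier K \<noteq> {}"
    using zero_mem compact_imp_bounded[OF compact_K] not_bounded_UNIV frontier_not_empty by blast
  then obtain x where x: "x \<in> frontier K" by blast
  define q0 where "q0 = fst \<circ> polygon (vertex x (grad g x))"
  have q0: "billiard_trajectory T K q0" "gauge_length K q0 = 4"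
    unfolding q0_def billiard_trajectory_def
    using two_bounce_trajectory[OF x grad_gauge_normal[OF x]] two_bounce_length[OF x] by blast+
  have arg_min: "is_arg_min (gauge_length K) (billiard_trajectory T K) q \<longleftrightarrow>
      billiard_trajectory T K q \<and> gauge_length K q = 4" for q
    unfolding is_arg_min_def using lower q0 by (metis antisym not_less)
  show ?thesis
    unfolding arg_min using lower q0 by blast
qed

end
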